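(* Let $\mathcal F$ be a Frobenius algebra over $R$ of the form $A=R[X]/((X-x_1)(X-x_2))$ described in the context, and suppose that $R$ is a unique factorization domain. Given a Plamenevskaya-type invariant $x_{\mathcal F}$, for each braid $B$ there exists $r=r(B)\in R$ such that either $x_{\mathcal F}(B)=r\,\beta_{\mathcal F}(B)$ or $x_{\mathcal F}(B)=r\,\overline\beta_{\mathcal F}(B)$. In particular, there is a bijection between Plamenevskaya-type invariants and $R$-valued invariants for transverse braids.
   Context: **Algebra.** Let $\mathbb F$ be a field, $R=\mathbb F[U,V]/(p,q)$ with $(p,q)$ a (possibly zero) prime ideal of $\mathbb F[U,V]$, and $x_1,x_2\in R$ (possibly equal). Put $A=R[X]/((X-x_1)(X-x_2))$, with product $m$, unit $\iota:R\to A$, counit $\epsilon:A\to R$ ($R$-linear, $\epsilon(1)=0$, $\epsilon(X)=1$) and coproduct $\Delta:A\to A\otimes_RA$, $\Delta(a)=(a\otimes1)(X\otimes1+1\otimes X-(x_1+x_2)\,1\otimes1)$. This is the Frobenius algebra $\mathcal F$. Put $x_\circ=X-x_1$, $x_\bullet=X-x_2$. **Complex.** Rotate a crossing of a link diagram so that the over-strand runs from SW to NE; its $0$-resolution joins SW to NW and SE to NE, its $1$-resolution joins SW to SE and NW to NE. A resolution $\underline r$ of an oriented diagram $D$ is the set of planar circles obtained by resolving every crossing; $|\underline r|$ is the number of $1$-resolutions used. Write $\underline r\prec\underline s$ if they differ at exactly one crossing, $0$-resolved in $\underline r$ and $1$-resolved in $\underline s$. A sign function assigns $\pm1$ to each pair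 $\underline r\prec\underline s$ so that for each square $\underline s_0\prec\underline s_1,\underline s_2\prec\underline s_3$ (four distinct resolutions) $\mathsf{sgn}(\underline s_0,\underline s_1)\mathsf{sgn}(\underline s_1,\underline s_3)=-\mathsf{sgn}(\underline s_0,\underline s_2)\mathsf{sgn}(\underline s_2,\underline s_3)$. Put $A_{\underline r}=\bigotimes_{\gamma\in\underline r}A_\gamma$ (a copy $A_\gamma$ of $A$ for each circle), $C^i_{\mathcal F}(D,R)=\bigoplus_{|\underline r|-n_-(D)=i}A_{\underline r}$, where $n_-(D)$ is the number of negative crossings, and let $d_{\mathcal F}$ on $A_{\underline r}$ be $\sum_{\underline r\prec\underline s}\mathsf{sgn}(\underline r,\underline s)d_{\underline r}^{\underline s}$, where $d_{\underline r}^{\underline s}$ applies $m$ to the labels of two merging circles or $\Delta$ to the label of a splitting circle, and the identity on the other circles. An enhanced state is an element $\bigotimes_{\gamma\in\underline r}\alpha_\gamma$ of some $A_{\underline r}$ (its underlying resolution is $\underline r$), and $\alpha_\gamma\in A$ is the label of $\gamma$. The oriented resolution is the one compatible with the orientation at every crossing; its summand is in degree $0$. **$\beta$-cycles.** For a circle $\gamma$ of the oriented resolution $\underline r$ of $D$, $N(\gamma)\in\mathbb Z/2$ is the number mod 2 of intersections of the circles of $\underline r$ with a generic path to infinity starting at a point of $\gamma$ pushed slightly to the left of $\gamma$. $\beta_{\mathcal F}(D,R)\in A_{\underline r}$ is the enhanced state in which $\gamma$ has label $x_\circ$ if $N(\gamma)=0$ and $x_\bullet$ if $N(\gamma)=1$;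 $\overline\beta_{\mathcal F}(D,R)$ is obtained by exchanging $x_\circ$ and $x_\bullet$. For a braid $B$ with closure $\widehat B$, $\beta_{\mathcal F}(B)=\beta_{\mathcal F}(\widehat B,R)$ and $\overline\beta_{\mathcal F}(B)=\overline\beta_{\mathcal F}(\widehat B,R)$. **Maps for Reidemeister moves.** Complexes of one diagram built from different sign functions are identified by the isomorphism acting on each $A_{\underline r}$ by $\pm\mathrm{id}$ and on the oriented resolution summand by $+\mathrm{id}$; planar isotopies induce the evident identifications. For an arc $\mathbf e$ meeting a diagram only at its endpoints, $\mathbf S(\cdot,\mathbf e)$ denotes the saddle map: on an enhanced state it applies $m$ to the labels of the two circles containing the endpoints of $\mathbf e$ if they are distinct, and $\Delta$ if they coincide. *$R_1^+$*: $D'_+$ is obtained from $D$ by adding a positive curl on an arc lying in the circle $\gamma'$ of a given resolution. $0$-resolving the new crossing gives $D\sqcup\bigcirc$ and $1$-resolving gives $D$, so $C_{\mathcal F}(D'_+)=(C_{\mathcal F}(D)\otimes_RA)\oplus C_{\mathcal F}(D)(-1)$ with the mapping cone differential of the saddle. Then $\Phi_1^+:C_{\mathcal F}(D)\to C_{\mathcal F}(D'_+)$ sends $\bigotimes_\gamma\alpha_\gamma$ to $\big(\bigotimes_{\gamma\ne\gamma'}\alpha_\gamma\big)\otimes\big(\alpha_{\gamma'}\otimes(x_\circ+x_\bullet)-\Delta(\alpha_{\gamma'})\big)\oplus0$ (second factor labels $\bigcirc$), and $\Psi_1^+:C_{\mathcal F}(D'_+)\to C_{\mathcal F}(D)$ sends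 $(x\otimes a)\oplus y$ to $\epsilon(a)x$. *$R_2$*: $D''$ is obtained from $D$ by a second move on arcs $\mathbf a,\mathbf b$, with new crossings $c_1,c_2$; $D''_{ij}$ is $D''$ with $c_1$ $i$-resolved and $c_2$ $j$-resolved, named so that $D''_{10}=D$ and $D''_{01}$ contains a small circle $\gamma''$. As modules $C_{\mathcal F}(D'')=\bigoplus_{ij}C_{\mathcal F}(D''_{ij})$ up to shifts (order $00,10,01,11$). Then $\Psi_2:C_{\mathcal F}(D)\to C_{\mathcal F}(D'')$, $\Psi_2(x)=0\oplus x\oplus\pm(\mathbf S(x,\mathbf e)\otimes\iota(1)_{\gamma''})\oplus0$ with $\mathbf e$ joining $\mathbf a$ and $\mathbf b$, and $\Phi_2:C_{\mathcal F}(D'')\to C_{\mathcal F}(D)$, $\Phi_2(x_{00}\oplus x_{10}\oplus x_{01}\oplus x_{11})=x_{10}\pm\epsilon(x_{\gamma''})\mathbf S(x_{01},\mathbf g)$, where $x_{\gamma''}$ is the label of $\gamma''$ in $x_{01}$, $\gamma''$ is then removed, and $\mathbf g$ joins the other two local arcs of $D''_{01}$; the signs are those making these chain maps. The move is coherent (braid-like) if $\mathbf a,\mathbf b$ are oriented parallel. *Coherent $R_3$*: the move $R_3^\circ$ replaces locally $D=\sigma_2^{-1}\sigma_1\sigma_2$ by $D'=\sigma_1\sigma_2\sigma_1^{-1}$. With $c$ the middle crossing and $D_i$ the $i$-resolution of $D$ at $c$, $C_{\mathcal F}(D)=\mathrm{Cone}(\mathbf S:C_{\mathcal F}(D_0)\to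 C_{\mathcal F}(D_1))$. $D_0$ is related by a coherent $R_2$ to $D''$ (three parallel strands); let $f=\Phi_2:C_{\mathcal F}(D_0)\to C_{\mathcal F}(D'')$, $g=\Psi_2$ in the other direction, and $h$ a homotopy on $C_{\mathcal F}(D_0)$ with $fg=\mathrm{id}$, $gf-\mathrm{id}=dh+hd$, $hg=0$. Put $\Phi:C_{\mathcal F}(D)\to\mathrm{Cone}(\mathbf Sg)$, $(x,y)\mapsto(fx,y\pm\mathbf Shx)$ (sign making it a chain map), and $\Psi:\mathrm{Cone}(\mathbf Sg)\to C_{\mathcal F}(D)$, $(x,y)\mapsto(gx,y)$. Define $\Phi',\Psi'$ analogously for $D'$; the two cones are identified because $D_1$ and $D_1'$ are planar isotopic. The maps of the move and of its inverse are $\Psi_3=\Psi'\circ\Phi$ and $\Phi_3=\Psi\circ\Phi'$. Every other coherent third move is a composition of coherent second moves and $R_3^\circ$ moves, and its map is the corresponding composition. **Transverse Markov moves.** Braids are braid words, $\sigma_i$ being a positive crossing. Transverse Markov moves: braid relations, conjugation, positive stabilization $B\in B_m\mapsto B\sigma_m\in B_{m+1}$ and its inverse. On closures, braid relations and conjugations are sequences of coherent $R_2$, coherent $R_3$ and planar isotopies; positive stabilization is an $R_1^+$ move adding a curl. For a sequence $\Sigma$ of such moves, $\Phi_\Sigma$ is the composition of the corresponding maps. An $R$-valued invariant for transverse braids is an $R$-valued function of braids that is invariant under transverse Markov moves. **Plamenevskaya-type invariant.** A function $x_{\mathcal F}$ associating to each braid $B$ a chain $x_{\mathcal F}(B)\in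 C^\bullet_{\mathcal F}(\widehat B,R)$ such that: $x_{\mathcal F}(B)$ is non-trivial (nonzero); $x_{\mathcal F}(B)$ is an enhanced state whose underlying resolution is the oriented resolution; and $\Phi_\Sigma(x_{\mathcal F}(B))=x_{\mathcal F}(B')$ for every sequence $\Sigma$ of transverse Markov moves from $B$ to $B'$.
   Formalization: The bijection with all R-valued invariants is claimed except when R has two elements and x_1 = x_2, where it is false (only one Plamenevskaya-type invariant exists); explicit bijections using nowhere-zero invariants (and a choice of β or its conjugate if x_1 ≠ x_2) are added. *)

theory Defs
  imports
    "HOL-Algebra.Algebraic_Closure_Type"
    "HOL-Library.Product_Plus"
    "HOL-Combinatorics.Transposition"
begin

section \<open>Closed braid-like diagrams and their resolutions\<close>

text \<open>
  All link diagrams that occur in transverse Markov moves, and all partial resolutions of them,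
  are closures of words in four kinds of elementary tangles on \<open>n\<close> strands. Strands are numbered
  \<open>0, \<dots>, n - 1\<close> from left to right and words are read from bottom to top, the orientation being
  upwards. \<open>Pos i\<close> is the braid generator in which the strands \<open>i\<close> and \<open>i + 1\<close> cross and the
  over-strand runs from SW to NE; \<open>Neg i\<close> is its inverse. \<open>Cup i\<close> joins the two lower ends of the
  strands \<open>i, i + 1\<close> and the two upper ends, and \<open>Straight\<close> has no crossing at all.
  The closing arcs run on the right of the word, so strand \<open>0\<close> is the outermost one.
\<close>

datatype letter = Pos nat | Neg nat | Cup nat | Straight

type_synonym diagram = "nat \<times> letter list"

text \<open>
  The point \<open>(k, i)\<close> lies on strand \<open>i\<close> just below the letter in position \<open>k\<close>; the level above the
  last letter is identified with level \<open>0\<close>. The empty word still has level \<open>0\<close>.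
\<close>

type_synonym point = "nat \<times> nat"
type_synonym circle = "point set"
type_synonym resolution = "nat set"

fun points :: "diagram \<Rightarrow> point set" where
  "points (n, w) = {..<max 1 (length w)} \<times> {..<n}"

fun crossings :: "diagram \<Rightarrow> nat set" where
  "crossings (n, w) = {k. k < length w \<and> (\<exists>i. w ! k = Pos i \<or> w ! k = Neg i)}"

text \<open>A resolution is the set of positions of the 1-resolved crossings.\<close>

fun resolve :: "bool \<Rightarrow> letter \<Rightarrow> letter" where
  "resolve one_res (Pos i) = (if one_res then Cup i else Straight)"
| "resolve one_res (Neg i) = (if one_res then Straight else Cup i)"
| "resolve one_res (Cup i) = Cup i"
| "resolve one_res Straight = Straight"

text \<open>The arcs of a letter without crossing between the levels \<open>k\<close> and \<open>k'\<close>.\<close>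

fun letter_arcs :: "nat \<Rightarrow> nat \<Rightarrow> nat \<Rightarrow> letter \<Rightarrow> (point \<times> point) set" where
  "letter_arcs n k k' (Cup i) =
     {((k, i), (k, Suc i)), ((k', i), (k', Suc i))} \<union>
     {((k, j), (k', j)) | j. j < n \<and> j \<noteq> i \<and> j \<noteq> Suc i}"
| "letter_arcs n k k' a = {((k, j), (k', j)) | j. j < n}"

fun arcs :: "diagram \<Rightarrow> resolution \<Rightarrow> (point \<times> point) set" where
  "arcs (n, w) r =
     (\<Union>k<length w. letter_arcs n k (Suc k mod length w) (resolve (k \<in> r) (w ! k)))"

text \<open>Circles are represented by the set of points they pass through.\<close>

definition circles :: "diagram \<Rightarrow> resolution \<Rightarrow> circle set" where
  "circles D r = (\<lambda>p. (arcs D r \<union> (arcs D r)\<inverse>)\<^sup>* `` {p}) ` points D"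

definition circle_of :: "circle set \<Rightarrow> point \<Rightarrow> circle" where
  "circle_of S p = (THE \<gamma>. \<gamma> \<in> S \<and> p \<in> \<gamma>)"

fun oriented_res :: "diagram \<Rightarrow> resolution" where
  "oriented_res (n, w) = {k. k < length w \<and> (\<exists>i. w ! k = Neg i)}"

definition n_minus :: "diagram \<Rightarrow> nat" where
  "n_minus D = card (oriented_res D)"

text \<open>
  The path from a point of \<open>\<gamma>\<close>, pushed to the left, to infinity is the horizontal ray to the left:
  by the conventions above it meets only the strands further left on the same level.
\<close>

definition nesting :: "diagram \<Rightarrow> circle \<Rightarrow> nat" where
  "nesting D \<gamma> = (let p = (SOME p. p \<in> \<gamma>) in
     card {p' \<in> \<Union> (circles D (oriented_res D)). fst p' = fst p \<and> snd p' < snd p})"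


section \<open>Braids and transverse Markov moves\<close>

typedef braid =
  "{D :: diagram. case D of (n, w) \<Rightarrow>
     n \<ge> 1 \<and> (\<forall>a \<in> set w. \<exists>i. Suc i < n \<and> (a = Pos i \<or> a = Neg i))}"
  by (rule exI[of _ "(1, [])"]) simp

definition closure_diagram :: "braid \<Rightarrow> diagram" where
  "closure_diagram B = Rep_braid B"

text \<open>
  Elementary moves generating the transverse Markov moves. \<open>R3 k\<close> is the coherent third move
  between \<open>Neg (i+1), Pos i, Pos (i+1)\<close> and \<open>Pos i, Pos (i+1), Neg i\<close> in the positions
  \<open>k, k+1, k+2\<close>, in either direction; all other third moves are composed of this one and of second
  moves. \<open>Far_Commute\<close> and the cyclic permutations \<open>Rotate\<close>, \<open>Unrotate\<close> are planar isotopies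
  of closures; a conjugation is a second move followed by cyclic permutations.
\<close>

datatype markov_move =
  R2_Create nat | R2_Cancel nat | Far_Commute nat | R3 nat
| Rotate | Unrotate | Stabilize | Destabilize

inductive applies :: "markov_move \<Rightarrow> diagram \<Rightarrow> diagram \<Rightarrow> bool" where
  create: "{a, b} = {Pos i, Neg i} \<Longrightarrow>
    applies (R2_Create (length u)) (n, u @ v) (n, u @ [a, b] @ v)"
| cancel: "{a, b} = {Pos i, Neg i} \<Longrightarrow>
    applies (R2_Cancel (length u)) (n, u @ [a, b] @ v) (n, u @ v)"
| commute: "a \<in> {Pos i, Neg i} \<Longrightarrow> b \<in> {Pos j, Neg j} \<Longrightarrow> i + 2 \<le> j \<or> j + 2 \<le> i \<Longrightarrow>
    applies (Far_Commute (length u)) (n, u @ [a, b] @ v) (n, u @ [b, a] @ v)"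
| R3: "applies (R3 (length u))
    (n, u @ [Neg (Suc i), Pos i, Pos (Suc i)] @ v) (n, u @ [Pos i, Pos (Suc i), Neg i] @ v)"
| R3_inverse: "applies (R3 (length u))
    (n, u @ [Pos i, Pos (Suc i), Neg i] @ v) (n, u @ [Neg (Suc i), Pos i, Pos (Suc i)] @ v)"
| rotate: "applies Rotate (n, a # u) (n, u @ [a])"
| unrotate: "applies Unrotate (n, u @ [a]) (n, a # u)"
| stabilize: "applies Stabilize (n, w) (Suc n, w @ [Pos (n - 1)])"
| destabilize: "applies Destabilize (Suc n, w @ [Pos (n - 1)]) (n, w)"

text \<open>Both ends of a destabilization are required to be braids below, so \<open>w\<close> does not involve
  the last strand.\<close>

definition braid_move :: "markov_move \<Rightarrow> braid \<Rightarrow> braid \<Rightarrow> bool" where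
  "braid_move \<mu> B B' \<longleftrightarrow> applies \<mu> (closure_diagram B) (closure_diagram B')"

definition transverse_invariant :: "(braid \<Rightarrow> 'a) \<Rightarrow> bool" where
  "transverse_invariant f \<longleftrightarrow> (\<forall>\<mu> B B'. braid_move \<mu> B B' \<longrightarrow> f B = f B')"


section \<open>Tensor products and chains\<close>

text \<open>
  An element \<open>(a, b)\<close> of \<open>'r \<times> 'r\<close> stands for \<open>a + b X\<close> in \<open>A\<close>. As \<open>A\<close> is free on \<open>1, X\<close>,
  the tensor product of copies of \<open>A\<close> over a finite set \<open>S\<close> of circles is free on the tensors of
  basis vectors; such a tensor is encoded by the set \<open>T \<subseteq> S\<close> of circles labelled \<open>X\<close>, and a general
  element by its coefficient function, which vanishes outside \<open>Pow S\<close>.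
\<close>

type_synonym 'r tensor = "circle set \<Rightarrow> 'r"
type_synonym 'r chain = "resolution \<Rightarrow> 'r tensor"

definition pure_tensor :: "circle set \<Rightarrow> (circle \<Rightarrow> 'r \<times> 'r) \<Rightarrow> 'r::idom tensor" where
  "pure_tensor S \<alpha> T =
     (if T \<subseteq> S then (\<Prod>\<gamma>\<in>S. if \<gamma> \<in> T then snd (\<alpha> \<gamma>) else fst (\<alpha> \<gamma>)) else 0)"

definition chains :: "diagram \<Rightarrow> 'r::idom chain set" where
  "chains D = {z. \<forall>r T. z r T \<noteq> 0 \<longrightarrow> r \<subseteq> crossings D \<and> T \<subseteq> circles D r}"

definition homogeneous :: "diagram \<Rightarrow> int \<Rightarrow> 'r::idom chain \<Rightarrow> bool" where
  "homogeneous D i z \<longleftrightarrow> (\<forall>r T. z r T \<noteq> 0 \<longrightarrow> int (card r) - int (n_minus D) = i)"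

definition scale :: "'r \<Rightarrow> 'r::idom chain \<Rightarrow> 'r chain" where
  "scale c z = (\<lambda>r T. c * z r T)"

definition chain_add :: "'r::idom chain \<Rightarrow> 'r chain \<Rightarrow> 'r chain" where
  "chain_add y z = (\<lambda>r T. y r T + z r T)"

definition chain_diff :: "'r::idom chain \<Rightarrow> 'r chain \<Rightarrow> 'r chain" where
  "chain_diff y z = (\<lambda>r T. y r T - z r T)"

definition pure_state :: "diagram \<Rightarrow> resolution \<Rightarrow> (circle \<Rightarrow> 'r \<times> 'r) \<Rightarrow> 'r::idom chain" where
  "pure_state D r \<alpha> = (\<lambda>s T. if s = r then pure_tensor (circles D r) \<alpha> T else 0)"

definition enhanced_state :: "diagram \<Rightarrow> resolution \<Rightarrow> 'r::idom chain \<Rightarrow> bool" where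
  "enhanced_state D r z \<longleftrightarrow> (\<exists>\<alpha>. z = pure_state D r \<alpha>)"

text \<open>
  Apply a linear map from the tensor product over \<open>G\<close> to the one over \<open>H\<close>, with matrix \<open>K\<close>, to the
  tensor factors in \<open>G\<close>, and the identity to the others. \<open>Q\<close> is the resulting set of circles.
\<close>

definition local_map :: "circle set \<Rightarrow> circle set \<Rightarrow> circle set \<Rightarrow>
    (circle set \<Rightarrow> 'r tensor) \<Rightarrow> 'r::idom tensor \<Rightarrow> 'r tensor" where
  "local_map G H Q K t = (\<lambda>T. if T \<subseteq> Q then
     (\<Sum>U\<in>Pow G. K U (T \<inter> H) * t ((T - H) \<union> U)) else 0)"

text \<open>
  The identification of tensor products induced by a planar isotopy: a circle in \<open>S\<close> corresponds
  to the circle in \<open>S'\<close> through the image under \<open>\<rho>\<close> of one of its points in \<open>M\<close>.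
\<close>

definition transport :: "circle set \<Rightarrow> circle set \<Rightarrow> point set \<Rightarrow> (point \<Rightarrow> point) \<Rightarrow>
    'r::idom tensor \<Rightarrow> 'r tensor" where
  "transport S S' M \<rho> t = (\<lambda>T. if T \<subseteq> S' then
     t {\<gamma> \<in> S. \<exists>p\<in>\<gamma> \<inter> M. \<exists>\<gamma>'\<in>T. \<rho> p \<in> \<gamma>'} else 0)"

text \<open>The standard sign function; \<open>edge_sign r c\<close> belongs to the pair \<open>r \<prec> insert c r\<close>.\<close>

definition edge_sign :: "resolution \<Rightarrow> nat \<Rightarrow> 'r::idom" where
  "edge_sign r c = (- 1) ^ card {c' \<in> r. c' < c}"

text \<open>
  Planar isotopy with bijection \<open>\<pi>\<close> of crossings. The sign is the change between the two sign
  functions: the parity of the inversions of \<open>\<pi>\<close> among the 1-resolved crossings, normalized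
  to be \<open>1\<close> on the oriented resolution.
\<close>

definition inversions :: "(nat \<Rightarrow> nat) \<Rightarrow> resolution \<Rightarrow> nat" where
  "inversions \<pi> r = card {(c, c'). c \<in> r \<and> c' \<in> r \<and> c < c' \<and> \<pi> c' < \<pi> c}"

definition isotopy :: "diagram \<Rightarrow> diagram \<Rightarrow> (nat \<Rightarrow> nat) \<Rightarrow> point set \<Rightarrow> (point \<Rightarrow> point) \<Rightarrow>
    'r::idom chain \<Rightarrow> 'r chain" where
  "isotopy D D' \<pi> M \<rho> z = (\<lambda>s T. if s \<subseteq> crossings D' then
     (let r = {c \<in> crossings D. \<pi> c \<in> s} in
       (- 1) ^ (inversions \<pi> r + inversions \<pi> (oriented_res D)) *
       transport (circles D r) (circles D' s) M \<rho> (z r) T) else 0)"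

text \<open>Second moves are performed between words of equal length, with \<open>Straight\<close> in place of the
  two crossings; these two isotopies insert and remove such a pair of letters in the positions
  \<open>k, k + 1\<close>. For the empty word \<open>mod\<close> has no effect.\<close>

definition insert_straight :: "diagram \<Rightarrow> diagram \<Rightarrow> nat \<Rightarrow> 'r::idom chain \<Rightarrow> 'r chain" where
  "insert_straight D D' k =
     isotopy D D' (\<lambda>c. if c < k then c else c + 2) UNIV
       (\<lambda>(j, i). (if j \<le> k then j else j + 2, i))"

definition remove_straight :: "diagram \<Rightarrow> diagram \<Rightarrow> nat \<Rightarrow> 'r::idom chain \<Rightarrow> 'r chain" where
  "remove_straight D D' k =
     isotopy D D' (\<lambda>c. if c < k then c else c - 2) {(j, i). j \<noteq> Suc k}
       (\<lambda>(j, i). ((if j \<le> k then j else j - 2) mod length (snd D'), i))"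


section \<open>The Frobenius algebra, the complex and the maps of the moves\<close>

locale frobenius_algebra =
  fixes x1 x2 :: "'r::idom"
begin

definition A_mult :: "'r \<times> 'r \<Rightarrow> 'r \<times> 'r \<Rightarrow> 'r \<times> 'r" where
  "A_mult a b = (fst a * fst b - x1 * x2 * (snd a * snd b),
                 fst a * snd b + snd a * fst b + (x1 + x2) * (snd a * snd b))"

definition A_one :: "'r \<times> 'r" where "A_one = (1, 0)"
definition A_X :: "'r \<times> 'r" where "A_X = (0, 1)"
definition x_circ :: "'r \<times> 'r" where "x_circ = A_X - (x1, 0)"
definition x_bullet :: "'r \<times> 'r" where "x_bullet = A_X - (x2, 0)"
definition counit :: "'r \<times> 'r \<Rightarrow> 'r" where "counit a = snd a"

lemma A_mult_quotient:
  "[:- x1, 1:] * [:- x2, 1:] dvd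
     [:fst a, snd a:] * [:fst b, snd b:] - [:fst (A_mult a b), snd (A_mult a b):]"
proof -
  have "[:fst a, snd a:] * [:fst b, snd b:] - [:fst (A_mult a b), snd (A_mult a b):]
      = [:- x1, 1:] * [:- x2, 1:] * [:snd a * snd b:]"
    by (simp add: A_mult_def algebra_simps)
  then show ?thesis by (metis dvd_triv_left)
qed

definition basis :: "bool \<Rightarrow> 'r \<times> 'r" where
  "basis b = (if b then A_X else A_one)"

text \<open>\<open>a \<otimes> b\<close> with \<open>a\<close> on \<open>\<gamma>\<close> and \<open>b\<close> on \<open>\<delta>\<close>.\<close>

definition tensor2 :: "circle \<Rightarrow> circle \<Rightarrow> 'r \<times> 'r \<Rightarrow> 'r \<times> 'r \<Rightarrow> 'r tensor" where
  "tensor2 \<gamma> \<delta> a b = pure_tensor {\<gamma>, \<delta>} (\<lambda>c. if c = \<gamma> then a else b)"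

definition comult :: "circle \<Rightarrow> circle \<Rightarrow> 'r \<times> 'r \<Rightarrow> 'r tensor" where
  "comult \<gamma> \<delta> a = (\<lambda>T. tensor2 \<gamma> \<delta> (A_mult a A_X) A_one T + tensor2 \<gamma> \<delta> a A_X T
                       - (x1 + x2) * tensor2 \<gamma> \<delta> a A_one T)"

definition merge :: "circle \<Rightarrow> circle \<Rightarrow> circle \<Rightarrow> circle set \<Rightarrow> 'r tensor \<Rightarrow> 'r tensor" where
  "merge \<gamma>1 \<gamma>2 \<delta> Q = local_map {\<gamma>1, \<gamma>2} {\<delta>} Q
     (\<lambda>U. pure_tensor {\<delta>} (\<lambda>_. A_mult (basis (\<gamma>1 \<in> U)) (basis (\<gamma>2 \<in> U))))"

definition split :: "circle \<Rightarrow> circle \<Rightarrow> circle \<Rightarrow> circle set \<Rightarrow> 'r tensor \<Rightarrow> 'r tensor" where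
  "split \<gamma> \<delta>1 \<delta>2 Q = local_map {\<gamma>} {\<delta>1, \<delta>2} Q (\<lambda>U. comult \<delta>1 \<delta>2 (basis (\<gamma> \<in> U)))"

text \<open>Insertion of \<open>\<iota>(1)\<close> on a new circle \<open>\<gamma>\<close>, and \<open>\<epsilon>\<close> on a circle \<open>\<gamma>\<close>, which disappears.\<close>

definition birth :: "circle \<Rightarrow> circle set \<Rightarrow> 'r tensor \<Rightarrow> 'r tensor" where
  "birth \<gamma> Q = local_map {} {\<gamma>} Q (\<lambda>_. pure_tensor {\<gamma>} (\<lambda>_. A_one))"

definition death :: "circle \<Rightarrow> circle set \<Rightarrow> 'r tensor \<Rightarrow> 'r tensor" where
  "death \<gamma> Q = local_map {\<gamma>} {} Q (\<lambda>U _. counit (basis (\<gamma> \<in> U)))"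

text \<open>
  The saddle map from the circles \<open>P\<close> to the circles \<open>Q\<close> obtained by surgery along one arc. As
  circles are point sets, those which are changed are exactly the ones in \<open>P - Q\<close>. The product
  is commutative and the coproduct is cocommutative, so the chosen order of two circles is
  irrelevant.
\<close>

definition saddle :: "circle set \<Rightarrow> circle set \<Rightarrow> 'r tensor \<Rightarrow> 'r tensor" where
  "saddle P Q =
     (let pick2 = (\<lambda>S. SOME (\<gamma>, \<delta>). \<gamma> \<noteq> \<delta> \<and> S = {\<gamma>, \<delta>}) in
      if card (P - Q) = 2
      then (let (\<gamma>1, \<gamma>2) = pick2 (P - Q) in merge \<gamma>1 \<gamma>2 (the_elem (Q - P)) Q)
      else (let (\<delta>1, \<delta>2) = pick2 (Q - P) in split (the_elem (P - Q)) \<delta>1 \<delta>2 Q))"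

definition differential :: "diagram \<Rightarrow> 'r chain \<Rightarrow> 'r chain" where
  "differential D z = (\<lambda>s T. if s \<subseteq> crossings D then
     (\<Sum>c\<in>s. edge_sign (s - {c}) c *
        saddle (circles D (s - {c})) (circles D s) (z (s - {c})) T) else 0)"

definition beta :: "braid \<Rightarrow> 'r chain" where
  "beta B = (let D = closure_diagram B in
     pure_state D (oriented_res D) (\<lambda>\<gamma>. if even (nesting D \<gamma>) then x_circ else x_bullet))"

definition beta_bar :: "braid \<Rightarrow> 'r chain" where
  "beta_bar B = (let D = closure_diagram B in
     pure_state D (oriented_res D) (\<lambda>\<gamma>. if even (nesting D \<gamma>) then x_bullet else x_circ))"

subsection \<open>First moves\<close>

text \<open>
  The new crossing is the last one, so its 0-resolved part carries the sign function of the
  original diagram. \<open>(0, n)\<close> lies on the new circle of the 0-resolution and \<open>(0, n - 1)\<close> on the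
  circle carrying the curl.
\<close>

fun Phi1 :: "diagram \<Rightarrow> diagram \<Rightarrow> 'r chain \<Rightarrow> 'r chain" where
  "Phi1 (n, w) D' z = (\<lambda>s T. if s \<subseteq> crossings D' \<and> length w \<notin> s then
     (let Q = circles D' s; \<omega> = circle_of Q (0, n); \<gamma> = circle_of Q (0, n - 1);
          t = transport (circles (n, w) s) (Q - {\<omega>}) UNIV id (z s)
      in local_map {\<gamma>} {\<gamma>, \<omega>} Q
           (\<lambda>U V. let a = basis (\<gamma> \<in> U) in
              tensor2 \<gamma> \<omega> a (x_circ + x_bullet) V - comult \<gamma> \<omega> a V) t T)
     else 0)"

fun Psi1 :: "diagram \<Rightarrow> diagram \<Rightarrow> 'r chain \<Rightarrow> 'r chain" where
  "Psi1 D' (n, w) y = (\<lambda>s T. if s \<subseteq> crossings (n, w) then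
     (let Q = circles D' s; \<omega> = circle_of Q (0, n)
      in transport (Q - {\<omega>}) (circles (n, w) s) UNIV (\<lambda>(j, i). (j mod length w, i))
           (death \<omega> (Q - {\<omega>}) (y s)) T)
     else 0)"

subsection \<open>Coherent second moves\<close>

text \<open>
  \<open>D'' = (n, w)\<close> has the two new crossings in the positions \<open>p < q\<close>, with only straight letters
  in between. The first of the two crossings in the numbering of the 4 partial resolutions is the
  negative one, as its 1-resolution is straight. \<open>r2_sign\<close> is the identification of the sign
  function of \<open>D\<close> with the one induced on the summand \<open>10\<close> of \<open>D''\<close>.
  The remaining signs are the ones which make the maps chain maps.
\<close>

fun r2_result :: "diagram \<Rightarrow> nat \<Rightarrow> nat \<Rightarrow> diagram" where
  "r2_result (n, w) p q = (n, w[p := Straight, q := Straight])"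

fun r2_crossings :: "diagram \<Rightarrow> nat \<Rightarrow> nat \<Rightarrow> nat \<times> nat" where
  "r2_crossings (n, w) p q = (if \<exists>i. w ! p = Neg i then (p, q) else (q, p))"

fun letter_index :: "letter \<Rightarrow> nat" where
  "letter_index (Pos i) = i"
| "letter_index (Neg i) = i"
| "letter_index (Cup i) = i"
| "letter_index Straight = 0"

definition r2_small_circle :: "diagram \<Rightarrow> nat \<Rightarrow> resolution \<Rightarrow> circle" where
  "r2_small_circle D'' p s = circle_of (circles D'' s) (Suc p, letter_index (snd D'' ! p))"

definition r2_sign :: "diagram \<Rightarrow> nat \<Rightarrow> resolution \<Rightarrow> 'r" where
  "r2_sign D p r = (- 1) ^ (card {c \<in> r. p < c} + card {c \<in> oriented_res D. p < c})"

definition Psi2 :: "diagram \<Rightarrow> nat \<Rightarrow> nat \<Rightarrow> 'r chain \<Rightarrow> 'r chain" where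
  "Psi2 D'' p q z = (let D = r2_result D'' p q; (c1, c2) = r2_crossings D'' p q in
     (\<lambda>s T. let r = s - {p, q} in
        if \<not> s \<subseteq> crossings D'' then 0
        else if s \<inter> {p, q} = {c1} then r2_sign D p r * z r T
        else if s \<inter> {p, q} = {c2} then
          (let Q = circles D'' s; \<gamma> = r2_small_circle D'' p s
           in r2_sign D p r * birth \<gamma> Q (saddle (circles D r) (Q - {\<gamma>}) (z r)) T)
        else 0))"

definition Phi2 :: "diagram \<Rightarrow> nat \<Rightarrow> nat \<Rightarrow> 'r chain \<Rightarrow> 'r chain" where
  "Phi2 D'' p q y = (let D = r2_result D'' p q; (c1, c2) = r2_crossings D'' p q in
     (\<lambda>r T. if r \<subseteq> crossings D then
        (let s = insert c2 r; Q = circles D'' s; \<gamma> = r2_small_circle D'' p s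
         in r2_sign D p r *
              (y (insert c1 r) T
               - saddle (Q - {\<gamma>}) (circles D r) (death \<gamma> (Q - {\<gamma>}) (y s)) T))
      else 0))"

subsection \<open>Coherent third moves\<close>

text \<open>
  \<open>r3_homotopy D0 p q h\<close>: \<open>h\<close> is a homotopy with the properties required in the definition of the
  maps of the third move, where \<open>f = Phi2 D0 p q\<close> and \<open>g = Psi2 D0 p q\<close>.
\<close>

definition r3_homotopy :: "diagram \<Rightarrow> nat \<Rightarrow> nat \<Rightarrow> ('r chain \<Rightarrow> 'r chain) \<Rightarrow> bool" where
  "r3_homotopy D0 p q h \<longleftrightarrow>
     (\<forall>z \<in> chains D0. h z \<in> chains D0) \<and>
     (\<forall>y \<in> chains D0. \<forall>z \<in> chains D0. h (chain_add y z) = chain_add (h y) (h z)) \<and>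
     (\<forall>c. \<forall>z \<in> chains D0. h (scale c z) = scale c (h z)) \<and>
     (\<forall>i. \<forall>z \<in> chains D0. homogeneous D0 i z \<longrightarrow> homogeneous D0 (i - 1) (h z)) \<and>
     (\<forall>z \<in> chains D0. chain_diff (Psi2 D0 p q (Phi2 D0 p q z)) z =
        chain_add (differential D0 (h z)) (h (differential D0 z))) \<and>
     (\<forall>z \<in> chains (r2_result D0 p q). h (Psi2 D0 p q z) = (\<lambda>_ _. 0))"

fun smooth_middle :: "diagram \<Rightarrow> nat \<Rightarrow> diagram" where
  "smooth_middle (n, w) k = (n, w[Suc k := Straight])"

text \<open>
  A choice of homotopies for all third moves; \<open>k\<close> is the position of the first of the three
  crossings. The move and its inverse use the same ones.
\<close>

definition homotopy_choice :: "(diagram \<Rightarrow> nat \<Rightarrow> 'r chain \<Rightarrow> 'r chain) \<Rightarrow> bool" where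
  "homotopy_choice H \<longleftrightarrow> (\<forall>k B B'. braid_move (R3 k) B B' \<longrightarrow>
     (let D0 = smooth_middle (closure_diagram B) k in r3_homotopy D0 k (k + 2) (H D0 k)))"

text \<open>
  The component of the differential at the crossing \<open>c\<close>. It is the map \<open>S\<close> of the cone
  \<open>C(D) = Cone(S : C(D\<^sub>0) \<rightarrow> C(D\<^sub>1))\<close>, with the signs of \<open>C(D)\<close> included; \<open>C(D\<^sub>0)\<close> and \<open>C(D\<^sub>1)\<close> are
  the parts of \<open>C(D)\<close> over the resolutions not containing and containing \<open>c\<close>. With
  these signs the sign in the chain map to \<open>Cone(S g)\<close> is \<open>+\<close>.
\<close>

definition differential_at :: "diagram \<Rightarrow> nat \<Rightarrow> 'r chain \<Rightarrow> 'r chain" where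
  "differential_at D c z = (\<lambda>s T. if s \<subseteq> crossings D \<and> c \<in> s then
     edge_sign (s - {c}) c * saddle (circles D (s - {c})) (circles D s) (z (s - {c})) T else 0)"

definition to_cone :: "(diagram \<Rightarrow> nat \<Rightarrow> 'r chain \<Rightarrow> 'r chain) \<Rightarrow> diagram \<Rightarrow> nat \<Rightarrow>
    'r chain \<Rightarrow> 'r chain \<times> 'r chain" where
  "to_cone H D k z =
     (let D0 = smooth_middle D k; c = Suc k;
          z0 = (\<lambda>r T. if c \<in> r then 0 else z r T);
          z1 = (\<lambda>r T. if c \<in> r then z r T else 0)
      in (Phi2 D0 k (k + 2) z0, chain_add z1 (differential_at D c (H D0 k z0))))"

definition from_cone :: "diagram \<Rightarrow> nat \<Rightarrow> 'r chain \<times> 'r chain \<Rightarrow> 'r chain" where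
  "from_cone D k = (\<lambda>(u, v). chain_add (Psi2 (smooth_middle D k) k (k + 2) u) v)"

text \<open>
  Identification of the cones of the two sides: the levels \<open>k + 1, k + 2\<close> are moved by the isotopy
  from \<open>D\<^sub>1\<close> to \<open>D'\<^sub>1\<close>, all others are fixed. It preserves the order of the crossings.
\<close>

definition cone_iso :: "diagram \<Rightarrow> diagram \<Rightarrow> nat \<Rightarrow>
    'r chain \<times> 'r chain \<Rightarrow> 'r chain \<times> 'r chain" where
  "cone_iso D D' k = (\<lambda>(u, v). (u, \<lambda>s T. if s \<subseteq> crossings D' \<and> Suc k \<in> s then
     transport (circles D s) (circles D' s) {(j, i). j \<noteq> k + 1 \<and> j \<noteq> k + 2} id (v s) T else 0))"

definition r3_map :: "(diagram \<Rightarrow> nat \<Rightarrow> 'r chain \<Rightarrow> 'r chain) \<Rightarrow> diagram \<Rightarrow> diagram \<Rightarrow> nat \<Rightarrow>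
    'r chain \<Rightarrow> 'r chain" where
  "r3_map H D D' k z = from_cone D' k (cone_iso D D' k (to_cone H D k z))"

subsection \<open>Plamenevskaya-type invariants\<close>

fun move_map :: "(diagram \<Rightarrow> nat \<Rightarrow> 'r chain \<Rightarrow> 'r chain) \<Rightarrow> markov_move \<Rightarrow>
    diagram \<Rightarrow> diagram \<Rightarrow> 'r chain \<Rightarrow> 'r chain" where
  "move_map H (R2_Create k) D D' z =
     Psi2 D' k (k + 1) (insert_straight D (r2_result D' k (k + 1)) k z)"
| "move_map H (R2_Cancel k) D D' z =
     remove_straight (r2_result D k (k + 1)) D' k (Phi2 D k (k + 1) z)"
| "move_map H (Far_Commute k) D D' z =
     isotopy D D' (transpose k (k + 1)) {(j, i). j \<noteq> k + 1} id z"
| "move_map H (R3 k) D D' z = r3_map H D D' k z"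
| "move_map H Rotate D D' z =
     (let l = length (snd D)
      in isotopy D D' (\<lambda>c. (c + l - 1) mod l) UNIV (\<lambda>(j, i). ((j + l - 1) mod l, i)) z)"
| "move_map H Unrotate D D' z =
     (let l = length (snd D)
      in isotopy D D' (\<lambda>c. (c + 1) mod l) UNIV (\<lambda>(j, i). ((j + 1) mod l, i)) z)"
| "move_map H Stabilize D D' z = Phi1 D D' z"
| "move_map H Destabilize D D' z = Psi1 D D' z"

text \<open>\<open>sequence_map H \<Sigma> B B' \<Phi>\<close>: \<open>\<Sigma>\<close> is a sequence of moves from \<open>B\<close> to \<open>B'\<close> with induced map \<open>\<Phi>\<close>.\<close>

inductive sequence_map :: "(diagram \<Rightarrow> nat \<Rightarrow> 'r chain \<Rightarrow> 'r chain) \<Rightarrow> markov_move list \<Rightarrow>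
    braid \<Rightarrow> braid \<Rightarrow> ('r chain \<Rightarrow> 'r chain) \<Rightarrow> bool"
  for H :: "diagram \<Rightarrow> nat \<Rightarrow> 'r chain \<Rightarrow> 'r chain" where
  nil: "sequence_map H [] B B id"
| snoc: "sequence_map H \<Sigma> B B' \<Phi> \<Longrightarrow> braid_move \<mu> B' B'' \<Longrightarrow>
    sequence_map H (\<Sigma> @ [\<mu>]) B B''
      (move_map H \<mu> (closure_diagram B') (closure_diagram B'') \<circ> \<Phi>)"

definition plamenevskaya_type ::
    "(diagram \<Rightarrow> nat \<Rightarrow> 'r chain \<Rightarrow> 'r chain) \<Rightarrow> (braid \<Rightarrow> 'r chain) \<Rightarrow> bool" where
  "plamenevskaya_type H x \<longleftrightarrow>
     (\<forall>B. x B \<noteq> (\<lambda>_ _. 0)) \<and>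
     (\<forall>B. enhanced_state (closure_diagram B) (oriented_res (closure_diagram B)) (x B)) \<and>
     (\<forall>\<Sigma> B B' \<Phi>. sequence_map H \<Sigma> B B' \<Phi> \<longrightarrow> \<Phi> (x B) = x B')"

end

end

theory Submission
  imports Defs "HOL-Library.Equipollence"
begin

text \<open>
  The oriented resolution of the closure of a braid on \<open>n\<close> strands is a family of \<open>n\<close> concentric
  circles, one for each strand, and the nesting number of the circle of strand \<open>j\<close> is \<open>j\<close>. An enhanced
  state on it is therefore a sequence \<open>l 0, \<dots>, l (n - 1)\<close> of labels in \<open>A\<close>, considered through the
  pure tensor which it defines (\<open>strand_state\<close>), and the two \<open>\<beta>\<close>-cycles are the sequences in which
  \<open>x_circ\<close> and \<open>x_bullet\<close> alternate.

  Every Plamenevskaya-type invariant is a multiple of a \<open>\<beta>\<close>-cycle for the following reason. Create two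
  crossings between the strands \<open>i\<close> and \<open>i + 1\<close>. The map of this move sends the chain to itself on the
  new oriented resolution, plus a correction term on the resolution where these two strands have been
  merged into one circle. The correction carries the label \<open>l i * l (i + 1)\<close> on the merged circle
  (\<open>Psi2_cup_component\<close>). As the value of the invariant on the new braid is again supported on the
  oriented resolution, the correction vanishes, and hence \<open>l i * l (i + 1) = 0\<close> for all \<open>i\<close>
  (\<open>adjacent_labels\<close>). In \<open>A = R[X]/((X - x1)(X - x2))\<close>, two nonzero elements with product zero are
  multiples of \<open>x_circ\<close> and of \<open>x_bullet\<close> in one of the two orders, because both polynomials have degree
  one; and \<open>x_circ\<close>, \<open>x_bullet\<close> are monic, so that the factors can be read off as the coefficients of
  \<open>X\<close>. So the labels alternate (\<open>zero_divisor_chain\<close>). A braid on a single strand has no pair of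
  neighbours; it is the destabilization of a braid on two strands.

  Conversely, a chain with alternating labels is mapped by each move to the chain with the same
  labels, with sign \<open>+\<close> (\<open>move_map_alternating\<close>): the correction term in the creation of two crossings contains the factor
  \<open>x_circ * x_bullet = 0\<close>, the first move continues the alternation on the new strand, and in
  the third move the chain lies in the image of the map \<open>g\<close> of a second move, on which the chosen
  homotopy vanishes, whatever it is elsewhere. Hence a Plamenevskaya-type invariant is the same as a nowhere
  vanishing transverse invariant, the coefficient, together with a choice of one of the two
  \<open>\<beta>\<close>-cycles which is itself a transverse invariant, and which makes a difference only if
  \<open>x1 \<noteq> x2\<close>.

  It remains to compare nowhere vanishing invariants with all invariants. Over an infinite ring
  this is done value by value. Over a finite ring it is a count: the self-linking number
  shows that there are infinitely many transverse classes of braids, and there are countably many braids, so the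
  invariants with values in any finite set with at least two elements are as many as the
  subsets of the natural numbers. For the field with two elements and \<open>x1 = x2\<close> this breaks down, as there is
  only one nowhere vanishing invariant.
\<close>

section \<open>Circles of the resolutions\<close>

definition strand :: "nat \<Rightarrow> nat \<Rightarrow> circle" where
  "strand L j = {..<max 1 L} \<times> {j}"

definition cup_free :: "letter list \<Rightarrow> bool" where
  "cup_free w \<longleftrightarrow> (\<forall>i. Cup i \<notin> set w)"

text \<open>
  The circles are the connected components of the graph of arcs. To recognize them it suffices to
  exhibit a partition into sets which no arc leaves and which are connected.
\<close>
lemma circles_eqI:
  assumes cover: "\<Union>\<C> = points D"
    and closed: "\<And>C a b. C \<in> \<C> \<Longrightarrow> (a, b) \<in> arcs D r \<Longrightarrow> a \<in> C \<longleftrightarrow> b \<in> C"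
    and connected: "\<And>C. C \<in> \<C> \<Longrightarrow> \<exists>b\<in>C. \<forall>y\<in>C. (b, y) \<in> (arcs D r \<union> (arcs D r)\<inverse>)\<^sup>*"
  shows "circles D r = \<C>"
proof -
  let ?R = "(arcs D r \<union> (arcs D r)\<inverse>)\<^sup>*"
  have sym: "(b, a) \<in> ?R" if "(a, b) \<in> ?R" for a b
    using that by (metis sym_rtrancl sym_Un_converse symD)
  have stay: "b \<in> C" if "(a, b) \<in> ?R" "a \<in> C" "C \<in> \<C>" for a b C
    using that(1,2) by (induction rule: rtrancl_induct) (use closed[OF that(3)] in auto)
  have cls: "?R `` {a} = C" if C: "C \<in> \<C>" and a: "a \<in> C" for C a
  proof -
    obtain b where b: "b \<in> C" "\<forall>y\<in>C. (b, y) \<in> ?R" using connected[OF C] by blast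
    then have "(a, y) \<in> ?R" if "y \<in> C" for y
      using that a sym by (metis rtrancl_trans)
    then show ?thesis using stay[OF _ a C] by auto
  qed
  show ?thesis
  proof
    show "circles D r \<subseteq> \<C>"
      using cls cover by (auto simp: circles_def simp flip: cover)
    show "\<C> \<subseteq> circles D r"
    proof
      fix C assume C: "C \<in> \<C>"
      then obtain a where a: "a \<in> C" using connected by blast
      then have "a \<in> points D" using C cover by blast
      then show "C \<in> circles D r" using cls[OF C a] by (auto simp: circles_def)
    qed
  qed
qed

lemma rtrancl_levels:
  assumes "\<And>k. a \<le> k \<Longrightarrow> k < b \<Longrightarrow> ((k, j), (Suc k, j)) \<in> R" and "a \<le> b"
  shows "((a, j), (b, j)) \<in> R\<^sup>*"
  using assms(2,1)
proof (induction b rule: dec_induct)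
  case (step m)
  then have "((a, j), (m, j)) \<in> R\<^sup>*" "((m, j), (Suc m, j)) \<in> R" by auto
  then show ?case by (rule rtrancl_into_rtrancl)
qed simp

definition locally_straight :: "nat \<Rightarrow> letter \<Rightarrow> bool" where
  "locally_straight j a \<longleftrightarrow> a = Straight \<or> (\<exists>i. a = Cup i \<and> j \<noteq> i \<and> j \<noteq> Suc i)"

lemma arcsI:
  assumes "k < length w" "e \<in> letter_arcs n k (Suc k mod length w) (resolve (k \<in> r) (w ! k))"
  shows "e \<in> arcs (n, w) r"
  using assms by auto

lemma arcsE:
  assumes "e \<in> arcs (n, w) r"
  obtains k where "k < length w" "e \<in> letter_arcs n k (Suc k mod length w) (resolve (k \<in> r) (w ! k))"
  using assms by auto

declare arcs.simps [simp del]

lemma arc_straight: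
  assumes "k < length w" "j < n" "locally_straight j (resolve (k \<in> r) (w ! k))"
  shows "((k, j), (Suc k mod length w, j)) \<in> arcs (n, w) r"
  using assms by (intro arcsI) (auto simp: locally_straight_def)

lemma circles_straight:
  assumes "\<And>k. k < length w \<Longrightarrow> resolve (k \<in> r) (w ! k) = Straight"
  shows "circles (n, w) r = strand (length w) ` {..<n}"
proof (rule circles_eqI)
  let ?L = "length w"
  show "\<Union> (strand ?L ` {..<n}) = points (n, w)" by (auto simp: strand_def)
  fix C assume C: "C \<in> strand ?L ` {..<n}"
  then obtain j where j: "j < n" "C = strand ?L j" by auto
  show "a \<in> C \<longleftrightarrow> b \<in> C" if "(a, b) \<in> arcs (n, w) r" for a b
  proof -
    from that obtain k where "k < ?L" "(a, b) \<in> letter_arcs n k (Suc k mod ?L) Straight"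
      by (rule arcsE) (use assms in auto)
    moreover from this have "Suc k mod ?L < ?L" by (intro mod_less_divisor) auto
    ultimately show ?thesis using j by (auto simp: strand_def)
  qed
  have "((0, j), (k, j)) \<in> (arcs (n, w) r \<union> (arcs (n, w) r)\<inverse>)\<^sup>*" if "k < max 1 ?L" for k
  proof (rule rtrancl_levels)
    fix k' assume "0 \<le> k'" "k' < k"
    then have "Suc k' < ?L" using that by auto
    then show "((k', j), (Suc k', j)) \<in> arcs (n, w) r \<union> (arcs (n, w) r)\<inverse>"
      using arc_straight[of k' w j n r] assms[of k'] j by (auto simp: locally_straight_def)
  qed simp
  then show "\<exists>b\<in>C. \<forall>y\<in>C. (b, y) \<in> (arcs (n, w) r \<union> (arcs (n, w) r)\<inverse>)\<^sup>*"
    using j by (intro bexI[of _ "(0, j)"]) (auto simp: strand_def)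
qed

lemma circles_oriented:
  assumes "cup_free w"
  shows "circles (n, w) (oriented_res (n, w)) = strand (length w) ` {..<n}"
proof (rule circles_straight)
  fix k assume "k < length w"
  then show "resolve (k \<in> oriented_res (n, w)) (w ! k) = Straight"
    using assms nth_mem[of k w] by (cases "w ! k") (auto simp: cup_free_def)
qed

definition inner_circle :: "nat \<Rightarrow> nat \<Rightarrow> nat \<Rightarrow> circle" where
  "inner_circle p q i = {p<..q} \<times> {i, Suc i}"

definition outer_circle :: "nat \<Rightarrow> nat \<Rightarrow> nat \<Rightarrow> nat \<Rightarrow> circle" where
  "outer_circle L p q i = ({..<L} - {p<..q}) \<times> {i, Suc i}"

text \<open>
  Two cups at the levels \<open>p < q\<close> between the strands \<open>i\<close> and \<open>i + 1\<close> cut these two strands into a small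
  circle, which runs between the levels, and a large one through the closing arcs. The large one
  contains level \<open>0\<close>, from which the levels up to \<open>p\<close> are reached upwards and those above \<open>q\<close> downwards
  across the closing arcs.
\<close>
lemma circles_two_cups:
  assumes pq: "p < q" "q < length w" and i: "Suc i < n"
    and cups: "resolve (p \<in> s) (w ! p) = Cup i" "resolve (q \<in> s) (w ! q) = Cup i"
    and straight: "\<And>k. k < length w \<Longrightarrow> k \<noteq> p \<Longrightarrow> k \<noteq> q \<Longrightarrow> resolve (k \<in> s) (w ! k) = Straight"
  shows "circles (n, w) s =
    strand (length w) ` ({..<n} - {i, Suc i}) \<union> {outer_circle (length w) p q i, inner_circle p q i}"
proof (rule circles_eqI)
  let ?L = "length w" and ?A = "arcs (n, w) s"
  let ?R = "?A \<union> ?A\<inverse>"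
  let ?C = "strand ?L ` ({..<n} - {i, Suc i}) \<union> {outer_circle ?L p q i, inner_circle p q i}"
  show "\<Union> ?C = points (n, w)"
    using pq i by (auto simp: strand_def outer_circle_def inner_circle_def)
  have letter: "(k = p \<or> k = q) \<and> resolve (k \<in> s) (w ! k) = Cup i \<or>
      (k \<noteq> p \<and> k \<noteq> q) \<and> resolve (k \<in> s) (w ! k) = Straight" if "k < ?L" for k
    using cups straight that by blast
  have up: "((k, j), (Suc k, j)) \<in> ?R" if "Suc k < ?L" "j < n" "k \<noteq> p \<and> k \<noteq> q \<or> j \<noteq> i \<and> j \<noteq> Suc i" for k j
    using arc_straight[of k w j n s] letter[of k] that by (auto simp: locally_straight_def)
  have across: "((k, i), (k, Suc i)) \<in> ?R" "((Suc k mod ?L, i), (Suc k mod ?L, Suc i)) \<in> ?R"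
    if "k = p \<or> k = q" for k
    using that pq cups arcsI[of k w "((k, i), (k, Suc i))" n s]
      arcsI[of k w "((Suc k mod ?L, i), (Suc k mod ?L, Suc i))" n s] by auto
  fix C assume C: "C \<in> ?C"
  show "a \<in> C \<longleftrightarrow> b \<in> C" if "(a, b) \<in> ?A" for a b
  proof -
    from that obtain k where k: "k < ?L" "(a, b) \<in> letter_arcs n k (Suc k mod ?L) (resolve (k \<in> s) (w ! k))"
      by (rule arcsE)
    have "Suc k mod ?L = (if Suc k = ?L then 0 else Suc k)" using k by auto
    then show ?thesis
      using letter[OF k(1)] k C pq
      by (auto simp: strand_def outer_circle_def inner_circle_def split: if_splits)
  qed
  consider j where "j < n" "j \<noteq> i" "j \<noteq> Suc i" "C = strand ?L j"
    | "C = outer_circle ?L p q i" | "C = inner_circle p q i"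
    using C by auto
  then show "\<exists>b\<in>C. \<forall>y\<in>C. (b, y) \<in> ?R\<^sup>*"
  proof cases
    case 1
    have "((0, j), (k, j)) \<in> ?R\<^sup>*" if "k < ?L" for k
      by (rule rtrancl_levels, rule up) (use 1 that in auto)
    then show ?thesis
      using 1 pq by (intro bexI[of _ "(0, j)"]) (auto simp: strand_def)
  next
    case 2
    have sym: "(b, a) \<in> ?R\<^sup>*" if "(a, b) \<in> ?R\<^sup>*" for a b
      using that by (metis sym_rtrancl sym_Un_converse symD)
    have low: "((0, j), (k, j)) \<in> ?R\<^sup>*" if "k \<le> p" "j = i \<or> j = Suc i" for k j
      by (rule rtrancl_levels, rule up) (use that pq i in auto)
    have top: "((Suc q, j), (k, j)) \<in> ?R\<^sup>*" if "q < k" "k < ?L" "j = i \<or> j = Suc i" for k j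
      by (rule rtrancl_levels, rule up) (use that pq i in auto)
    \<comment> \<open>This is where the word closes up: the level above the last letter is level \<open>0\<close>.\<close>
    have wrap: "((?L - 1, j), (0, j)) \<in> ?R" if "Suc q < ?L" "j = i \<or> j = Suc i" for j
    proof -
      have L: "?L - 1 < ?L" "?L - 1 \<noteq> p" "?L - 1 \<noteq> q" "Suc (?L - 1) = ?L"
        using that pq by auto
      have "locally_straight j (resolve (?L - 1 \<in> s) (w ! (?L - 1)))"
        using letter[OF L(1)] L(2,3) by (auto simp: locally_straight_def)
      then have "((?L - 1, j), (Suc (?L - 1) mod ?L, j)) \<in> ?A"
        by (rule arc_straight[OF L(1), rotated]) (use that i in auto)
      then show ?thesis unfolding L(4) mod_self by blast
    qed
    have col: "((0, j), (k, j)) \<in> ?R\<^sup>*" if "k < ?L" "k \<le> p \<or> q < k" "j = i \<or> j = Suc i" for k j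
    proof (cases "k \<le> p")
      case False
      then have "q < k" using that by simp
      have "((0, j), (?L - 1, j)) \<in> ?R\<^sup>*" using wrap[of j] sym that \<open>q < k\<close> by (meson r_into_rtrancl le_less_trans Suc_leI)
      moreover have "((?L - 1, j), (Suc q, j)) \<in> ?R\<^sup>*" using sym[OF top[of "?L - 1" j]] that \<open>q < k\<close> by auto
      ultimately show ?thesis using top[of k j] that \<open>q < k\<close> by (meson rtrancl_trans)
    qed (use low that in auto)
    have "((0, i), (0, Suc i)) \<in> ?R\<^sup>*"
      using low[of p i] across(1)[of p] sym[OF low[of p "Suc i"]]
      by (meson rtrancl_trans r_into_rtrancl order_refl)
    then have "((0, i), (k, j)) \<in> ?R\<^sup>*" if "k < ?L" "k \<le> p \<or> q < k" "j = i \<or> j = Suc i" for k j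
      using col that by (metis rtrancl_trans)
    then show ?thesis
      using 2 pq by (intro bexI[of _ "(0, i)"]) (auto simp: outer_circle_def)
  next
    case 3
    have col: "((Suc p, j), (k, j)) \<in> ?R\<^sup>*" if "p < k" "k \<le> q" "j = i \<or> j = Suc i" for k j
      by (rule rtrancl_levels, rule up) (use that pq i in auto)
    have "((Suc p, i), (Suc p, Suc i)) \<in> ?R\<^sup>*" using across(2)[of p] pq by auto
    then have "((Suc p, i), (k, j)) \<in> ?R\<^sup>*" if "p < k" "k \<le> q" "j = i \<or> j = Suc i" for k j
      using col that by (metis rtrancl_trans)
    then show ?thesis
      using 3 pq by (intro bexI[of _ "(Suc p, i)"]) (auto simp: inner_circle_def)
  qed
qed

section \<open>Pure tensors\<close>
lemma pure_tensor_Un: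
  assumes "finite P" "finite P'" "P \<inter> P' = {}" "T \<subseteq> P" "T' \<subseteq> P'"
  shows "pure_tensor (P \<union> P') \<alpha> (T \<union> T') = pure_tensor P \<alpha> T * pure_tensor P' \<alpha> T'"
proof -
  have "(\<Prod>\<gamma>\<in>P. if \<gamma> \<in> T \<union> T' then snd (\<alpha> \<gamma>) else fst (\<alpha> \<gamma>)) =
      (\<Prod>\<gamma>\<in>P. if \<gamma> \<in> T then snd (\<alpha> \<gamma>) else fst (\<alpha> \<gamma>))"
    "(\<Prod>\<gamma>\<in>P'. if \<gamma> \<in> T \<union> T' then snd (\<alpha> \<gamma>) else fst (\<alpha> \<gamma>)) =
      (\<Prod>\<gamma>\<in>P'. if \<gamma> \<in> T' then snd (\<alpha> \<gamma>) else fst (\<alpha> \<gamma>))"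
    using assms by (auto intro!: prod.cong)
  moreover have "T \<union> T' \<subseteq> P \<union> P'" using assms by blast
  ultimately show ?thesis
    using assms by (simp add: pure_tensor_def prod.union_disjoint)
qed

lemma pure_tensor_cong:
  "(\<And>\<gamma>. \<gamma> \<in> S \<Longrightarrow> \<alpha> \<gamma> = \<beta> \<gamma>) \<Longrightarrow> pure_tensor S \<alpha> = pure_tensor S \<beta>"
  by (auto simp: pure_tensor_def fun_eq_iff intro!: prod.cong)

text \<open>
  A pure tensor of nonzero labels has a nonzero coefficient, because the scalars form a domain: choose \<open>X\<close> on
  each circle whose label involves \<open>X\<close>, and \<open>1\<close> on the others.
\<close>
lemma pure_tensor_eq_0_iff:
  assumes "finite S"
  shows "pure_tensor S \<alpha> = (\<lambda>_. 0) \<longleftrightarrow> (\<exists>\<gamma>\<in>S. \<alpha> \<gamma> = 0)"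
proof
  assume zero: "pure_tensor S \<alpha> = (\<lambda>_. 0)"
  have "pure_tensor S \<alpha> {\<gamma>\<in>S. snd (\<alpha> \<gamma>) \<noteq> 0} = 0" using zero by simp
  then show "\<exists>\<gamma>\<in>S. \<alpha> \<gamma> = 0"
    using assms by (auto simp: pure_tensor_def prod_eq_iff split: if_splits)
next
  assume "\<exists>\<gamma>\<in>S. \<alpha> \<gamma> = 0"
  then show "pure_tensor S \<alpha> = (\<lambda>_. 0)"
    using assms by (force simp: pure_tensor_def fun_eq_iff)
qed

lemma pure_tensor_scale:
  "pure_tensor S (\<lambda>\<gamma>. (c \<gamma> * fst (\<alpha> \<gamma>), c \<gamma> * snd (\<alpha> \<gamma>))) T = prod c S * pure_tensor S \<alpha> T"
  by (auto simp: pure_tensor_def prod.distrib[symmetric] intro!: prod.cong)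

text \<open>
  All maps between complexes are local, and the chains of interest are pure tensors. This lemma reduces
  the computation of such a map to the circles on which it acts.
\<close>
lemma local_map_pure_tensor:
  assumes fin: "finite P" "finite H" and G: "G \<subseteq> P" and H: "H \<inter> (P - G) = {}"
    and Q: "Q = H \<union> (P - G)"
    and local: "\<And>V. V \<subseteq> H \<Longrightarrow> (\<Sum>U\<in>Pow G. K U V * pure_tensor G \<alpha> U) = pure_tensor H \<beta> V"
    and rest: "\<And>\<gamma>. \<gamma> \<in> P - G \<Longrightarrow> \<beta> \<gamma> = \<alpha> \<gamma>"
  shows "local_map G H Q K (pure_tensor P \<alpha>) = pure_tensor Q \<beta>"
proof
  fix T
  show "local_map G H Q K (pure_tensor P \<alpha>) T = pure_tensor Q \<beta> T"
  proof (cases "T \<subseteq> Q")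
    case True
    have "pure_tensor P \<alpha> ((T - H) \<union> U) = pure_tensor (P - G) \<alpha> (T - H) * pure_tensor G \<alpha> U"
      if "U \<subseteq> G" for U
    proof -
      have "P = (P - G) \<union> G" using G by blast
      then show ?thesis
        using pure_tensor_Un[of "P - G" G "T - H" U \<alpha>] that True Q fin G finite_subset[OF G]
        by (metis Diff_disjoint Diff_subset_conv Un_Diff_cancel Un_commute finite_Diff inf_commute)
    qed
    then have "local_map G H Q K (pure_tensor P \<alpha>) T =
        (\<Sum>U\<in>Pow G. K U (T \<inter> H) * pure_tensor G \<alpha> U) * pure_tensor (P - G) \<alpha> (T - H)"
      using True by (simp add: local_map_def sum_distrib_left mult_ac)
    also have "\<dots> = pure_tensor H \<beta> (T \<inter> H) * pure_tensor (P - G) \<beta> (T - H)"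
      using local[of "T \<inter> H"] pure_tensor_cong[of "P - G" \<beta> \<alpha>] rest by simp
    also have "\<dots> = pure_tensor (H \<union> (P - G)) \<beta> ((T \<inter> H) \<union> (T - H))"
      using True Q fin H by (intro pure_tensor_Un[symmetric]) auto
    also have "(T \<inter> H) \<union> (T - H) = T" by blast
    finally show ?thesis by (simp add: Q)
  qed (simp add: local_map_def pure_tensor_def)
qed

lemma local_map_zero: "local_map G H Q K (\<lambda>_. 0) = (\<lambda>_. 0)"
  by (simp add: local_map_def fun_eq_iff)

lemma transport_zero: "transport S S' M \<rho> (\<lambda>_. 0) = (\<lambda>_. 0)"
  by (simp add: transport_def fun_eq_iff)

text \<open>
  Labels are indexed by strands, and \<open>strand_index\<close> recovers the strand from the circle. The choice of a
  point is harmless for the circles of the oriented resolution, each of which stays on one strand.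
\<close>
definition strand_index :: "circle \<Rightarrow> nat" where
  "strand_index \<gamma> = snd (SOME p. p \<in> \<gamma>)"

lemma strand_nonempty: "(0, j) \<in> strand L j"
  by (auto simp: strand_def)

lemma strand_index_strand [simp]: "strand_index (strand L j) = j"
  using someI[of "\<lambda>p. p \<in> strand L j", OF strand_nonempty]
  by (auto simp: strand_index_def strand_def)

lemma inj_strand: "inj_on (strand L) S"
  by (metis inj_onI strand_index_strand)

lemma mem_strand_iff: "p \<in> strand L j \<longleftrightarrow> fst p < max 1 L \<and> snd p = j"
  by (cases p) (auto simp: strand_def)

lemma transport_strands:
  assumes meet: "\<And>j. j \<in> N \<Longrightarrow> strand L j \<inter> M \<noteq> {}"
    and move: "\<And>j p. j \<in> N \<Longrightarrow> p \<in> strand L j \<Longrightarrow> p \<in> M \<Longrightarrow> \<rho> p \<in> strand L' j"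
  shows "transport (strand L ` N) (strand L' ` N) M \<rho>
      (pure_tensor (strand L ` N) (\<lambda>\<gamma>. l (strand_index \<gamma>))) =
    pure_tensor (strand L' ` N) (\<lambda>\<gamma>. l (strand_index \<gamma>))"
proof
  fix T
  let ?P = "strand L ` N" and ?P' = "strand L' ` N" and ?l = "\<lambda>\<gamma>. l (strand_index \<gamma>)"
  show "transport ?P ?P' M \<rho> (pure_tensor ?P ?l) T = pure_tensor ?P' ?l T"
  proof (cases "T \<subseteq> ?P'")
    case True
    let ?J = "{j \<in> N. strand L' j \<in> T}"
    have same: "(\<exists>p\<in>strand L j \<inter> M. \<exists>\<gamma>'\<in>T. \<rho> p \<in> \<gamma>') \<longleftrightarrow> strand L' j \<in> T" if j: "j \<in> N" for j
    proof
      assume "\<exists>p\<in>strand L j \<inter> M. \<exists>\<gamma>'\<in>T. \<rho> p \<in> \<gamma>'"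
      then obtain p \<gamma>' where p: "p \<in> strand L j" "p \<in> M" "\<gamma>' \<in> T" "\<rho> p \<in> \<gamma>'" by blast
      then obtain j' where j': "\<gamma>' = strand L' j'" using True by auto
      have "j' = j" using move[OF j p(1,2)] p(4) j' by (auto simp: mem_strand_iff)
      then show "strand L' j \<in> T" using p j' by simp
    next
      assume "strand L' j \<in> T"
      moreover obtain p where "p \<in> strand L j \<inter> M" using meet[OF j] by blast
      ultimately show "\<exists>p\<in>strand L j \<inter> M. \<exists>\<gamma>'\<in>T. \<rho> p \<in> \<gamma>'"
        using move[OF j, of p] by blast
    qed
    have "{\<gamma> \<in> ?P. \<exists>p\<in>\<gamma> \<inter> M. \<exists>\<gamma>'\<in>T. \<rho> p \<in> \<gamma>'} = strand L ` ?J"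
      using same by blast
    moreover have "strand L j \<in> strand L ` ?J \<longleftrightarrow> strand L' j \<in> T" if "j \<in> N" for j
      using that by (metis (mono_tags, lifting) imageE image_eqI mem_Collect_eq strand_index_strand)
    then have "(\<Prod>\<gamma>\<in>?P. if \<gamma> \<in> strand L ` ?J then snd (?l \<gamma>) else fst (?l \<gamma>)) =
        (\<Prod>\<gamma>\<in>?P'. if \<gamma> \<in> T then snd (?l \<gamma>) else fst (?l \<gamma>))"
      by (auto simp: prod.reindex[OF inj_strand] intro!: prod.cong)
    ultimately show ?thesis using True by (auto simp: transport_def pure_tensor_def)
  qed (simp add: transport_def pure_tensor_def)
qed

context frobenius_algebra
begin

lemma A_mult_commute: "A_mult a b = A_mult b a"
  by (simp add: A_mult_def algebra_simps)

lemma Pow_doubleton: "Pow {a, b} = {{}, {a}, {b}, {a, b}}"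
  by (auto simp: Pow_insert)

lemma merge_pure_tensor:
  assumes "finite R" "\<gamma>1 \<noteq> \<gamma>2" "\<gamma>1 \<notin> R" "\<gamma>2 \<notin> R" "\<delta> \<notin> R"
  shows "merge \<gamma>1 \<gamma>2 \<delta> (insert \<delta> R) (pure_tensor ({\<gamma>1, \<gamma>2} \<union> R) \<alpha>) =
    pure_tensor (insert \<delta> R) (\<alpha>(\<delta> := A_mult (\<alpha> \<gamma>1) (\<alpha> \<gamma>2)))"
  unfolding merge_def
proof (rule local_map_pure_tensor)
  fix V :: "circle set" assume "V \<subseteq> {\<delta>}"
  then have "V = {} \<or> V = {\<delta>}" by blast
  then show "(\<Sum>U\<in>Pow {\<gamma>1, \<gamma>2}. pure_tensor {\<delta>} (\<lambda>_. A_mult (basis (\<gamma>1 \<in> U)) (basis (\<gamma>2 \<in> U))) V *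
        pure_tensor {\<gamma>1, \<gamma>2} \<alpha> U) = pure_tensor {\<delta>} (\<alpha>(\<delta> := A_mult (\<alpha> \<gamma>1) (\<alpha> \<gamma>2))) V"
    using assms(2)
    by (auto simp: Pow_doubleton pure_tensor_def A_mult_def basis_def A_X_def A_one_def algebra_simps)
qed (use assms in auto)

text \<open>
  The saddle map chooses an order of the two circles to be merged; commutativity of \<open>A\<close> makes it
  immaterial.
\<close>
lemma saddle_pure_tensor:
  assumes "finite R" "\<gamma>1 \<noteq> \<gamma>2" "\<gamma>1 \<notin> R" "\<gamma>2 \<notin> R" "\<delta> \<notin> R" "\<delta> \<noteq> \<gamma>1" "\<delta> \<noteq> \<gamma>2"
  shows "saddle ({\<gamma>1, \<gamma>2} \<union> R) (insert \<delta> R) (pure_tensor ({\<gamma>1, \<gamma>2} \<union> R) \<alpha>) =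
    pure_tensor (insert \<delta> R) (\<alpha>(\<delta> := A_mult (\<alpha> \<gamma>1) (\<alpha> \<gamma>2)))"
proof -
  let ?P = "{\<gamma>1, \<gamma>2} \<union> R" and ?Q = "insert \<delta> R"
  have diffs: "?P - ?Q = {\<gamma>1, \<gamma>2}" "?Q - ?P = {\<delta>}" using assms by auto
  define c where "c = (SOME (\<gamma>, \<gamma>'). \<gamma> \<noteq> \<gamma>' \<and> {\<gamma>1, \<gamma>2} = {\<gamma>, \<gamma>'})"
  have "case c of (\<gamma>, \<gamma>') \<Rightarrow> \<gamma> \<noteq> \<gamma>' \<and> {\<gamma>1, \<gamma>2} = {\<gamma>, \<gamma>'}"
    unfolding c_def by (rule someI[of _ "(\<gamma>1, \<gamma>2)"]) (use assms in auto)
  then have c: "c = (\<gamma>1, \<gamma>2) \<or> c = (\<gamma>2, \<gamma>1)"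
    by (auto simp: doubleton_eq_iff)
  have "saddle ?P ?Q (pure_tensor ?P \<alpha>) =
      (case c of (\<gamma>, \<gamma>') \<Rightarrow> merge \<gamma> \<gamma>' \<delta> ?Q (pure_tensor ?P \<alpha>))"
    unfolding saddle_def diffs Let_def c_def using assms(2) by (simp add: case_prod_beta)
  then show ?thesis
    using c merge_pure_tensor[OF assms(1-5), of \<alpha>]
      merge_pure_tensor[OF assms(1) assms(2)[symmetric] assms(4,3,5), of \<alpha>]
    by (auto simp: insert_commute A_mult_commute)
qed

lemma saddle_zero: "saddle P Q (\<lambda>_. 0) = (\<lambda>_. 0)"
  by (simp add: saddle_def Let_def merge_def split_def local_map_zero split: prod.splits)

lemma birth_pure_tensor:
  assumes "finite Q" "\<gamma> \<in> Q"
  shows "birth \<gamma> Q (pure_tensor (Q - {\<gamma>}) \<alpha>) = pure_tensor Q (\<alpha>(\<gamma> := A_one))"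
  unfolding birth_def
  by (rule local_map_pure_tensor) (use assms in \<open>auto simp: pure_tensor_def\<close>)

text \<open>
  Both \<open>x_circ\<close> and \<open>x_bullet\<close> are monic, so capping off a circle labelled by one of them just forgets it.
\<close>
lemma death_pure_tensor:
  assumes "finite Q" "\<gamma> \<in> Q" "counit (\<alpha> \<gamma>) = 1"
  shows "death \<gamma> (Q - {\<gamma>}) (pure_tensor Q \<alpha>) = pure_tensor (Q - {\<gamma>}) \<alpha>"
  unfolding death_def
  by (rule local_map_pure_tensor)
    (use assms in \<open>auto simp: pure_tensor_def Pow_insert counit_def basis_def A_X_def A_one_def\<close>)

end

declare oriented_res.simps [simp del] crossings.simps [simp del]

section \<open>States on the oriented resolution\<close>
lemma crossings_iff: "k \<in> crossings (n, w) \<longleftrightarrow> k < length w \<and> (\<exists>i. w ! k = Pos i \<or> w ! k = Neg i)"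
  by (simp add: crossings.simps)

lemma oriented_res_iff: "k \<in> oriented_res (n, w) \<longleftrightarrow> k < length w \<and> (\<exists>i. w ! k = Neg i)"
  by (simp add: oriented_res.simps)

lemma oriented_res_subset: "oriented_res D \<subseteq> crossings D"
  by (cases D) (auto simp: crossings_iff oriented_res_iff)

definition strand_state :: "diagram \<Rightarrow> (nat \<Rightarrow> 'r \<times> 'r) \<Rightarrow> 'r::idom chain" where
  "strand_state D l = pure_state D (oriented_res D) (\<lambda>\<gamma>. l (strand_index \<gamma>))"

lemma strand_state_apply:
  assumes "cup_free w"
  shows "strand_state (n, w) l r = (if r = oriented_res (n, w)
    then pure_tensor (strand (length w) ` {..<n}) (\<lambda>\<gamma>. l (strand_index \<gamma>)) else (\<lambda>_. 0))"
  by (simp add: strand_state_def pure_state_def fun_eq_iff circles_oriented[OF assms])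

lemma strand_state_in_chains: "strand_state D l \<in> chains D"
  using oriented_res_subset[of D]
  by (auto simp: strand_state_def chains_def pure_state_def pure_tensor_def split: if_splits)

text \<open>
  A planar isotopy matches the crossings with their signs, hence the oriented resolutions, on which
  the sign of the isotopy map is normalized to \<open>1\<close>; and it keeps every strand in its place.
\<close>
lemma isotopy_strand_state:
  assumes w: "cup_free w" "cup_free w'"
    and bij: "bij_betw \<pi> (crossings (n, w)) (crossings (n, w'))"
    and same: "\<And>c. c \<in> crossings (n, w) \<Longrightarrow> w' ! \<pi> c = w ! c"
    and meet: "\<And>j. j < n \<Longrightarrow> strand (length w) j \<inter> M \<noteq> {}"
    and move: "\<And>j p. j < n \<Longrightarrow> p \<in> strand (length w) j \<Longrightarrow> p \<in> M \<Longrightarrow> \<rho> p \<in> strand (length w') j"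
  shows "isotopy (n, w) (n, w') \<pi> M \<rho> (strand_state (n, w) l) = strand_state (n, w') l"
proof (intro ext)
  fix s T
  let ?D = "(n, w)" and ?D' = "(n, w')"
  let ?r = "{c \<in> crossings ?D. \<pi> c \<in> s}"
  have onto: "k \<in> \<pi> ` crossings ?D" if "k \<in> crossings ?D'" for k
    using bij that by (auto simp: bij_betw_def)
  have fwd: "\<pi> c \<in> crossings ?D'" if "c \<in> crossings ?D" for c
    using bij that by (auto simp: bij_betw_def)
  have neg: "\<pi> c \<in> oriented_res ?D' \<longleftrightarrow> c \<in> oriented_res ?D" if "c \<in> crossings ?D" for c
    using same[OF that] fwd[OF that] that by (auto simp: oriented_res_iff crossings_iff)
  show "isotopy ?D ?D' \<pi> M \<rho> (strand_state ?D l) s T = strand_state ?D' l s T"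
  proof (cases "s \<subseteq> crossings ?D'")
    case sub: True
    have r: "?r = oriented_res ?D \<longleftrightarrow> s = oriented_res ?D'"
    proof
      assume "s = oriented_res ?D'"
      then show "?r = oriented_res ?D" using neg oriented_res_subset[of ?D] by blast
    next
      assume r: "?r = oriented_res ?D"
      have "k \<in> s \<longleftrightarrow> k \<in> oriented_res ?D'" if "k \<in> crossings ?D'" for k
        using onto[OF that] r neg by auto
      then show "s = oriented_res ?D'" using sub oriented_res_subset[of ?D'] by blast
    qed
    show ?thesis
    proof (cases "s = oriented_res ?D'")
      case True
      then have r': "?r = oriented_res ?D" using r by simp
      have "isotopy ?D ?D' \<pi> M \<rho> (strand_state ?D l) s T =
          transport (circles ?D (oriented_res ?D)) (circles ?D' s) M \<rho> (strand_state ?D l (oriented_res ?D)) T"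
        using sub by (simp add: isotopy_def Let_def r' mult_2[symmetric] power_mult)
      also have "\<dots> = strand_state ?D' l s T"
        using transport_strands[of "{..<n}" "length w" M \<rho> "length w'" l] meet move
        by (simp add: True circles_oriented w strand_state_apply)
      finally show ?thesis .
    next
      case False
      then have "?r \<noteq> oriented_res ?D" using r by simp
      then show ?thesis using False by (simp add: isotopy_def Let_def strand_state_apply w transport_zero)
    qed
  next
    case False
    then show ?thesis using oriented_res_subset[of ?D']
      by (auto simp: isotopy_def strand_state_apply w)
  qed
qed

section \<open>Second moves\<close>

text \<open>
  The two crossings of a second move between the strands \<open>i\<close> and \<open>i + 1\<close>. Straight letters are allowed
  between them, because in the third move the smoothed middle crossing lies there.
\<close>
definition second_move_site :: "nat \<Rightarrow> letter list \<Rightarrow> nat \<Rightarrow> nat \<Rightarrow> nat \<Rightarrow> bool" where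
  "second_move_site n w p q i \<longleftrightarrow> cup_free w \<and> p < q \<and> q < length w \<and> Suc i < n \<and>
     {w ! p, w ! q} = {Pos i, Neg i} \<and> (\<forall>k. p < k \<longrightarrow> k < q \<longrightarrow> w ! k = Straight)"

context frobenius_algebra
begin

text \<open>
  Here \<open>c1\<close> is the negative crossing and \<open>c2\<close> the positive one. The resolution with only \<open>c1\<close> among the new
  crossings is the oriented one; the one with only \<open>c2\<close> has cups at both crossings.
\<close>
lemma second_move_site_facts:
  assumes site: "second_move_site n w p q i" and r2: "r2_crossings (n, w) p q = (c1, c2)"
  defines "w0 \<equiv> w[p := Straight, q := Straight]"
  shows "{c1, c2} = {p, q}" "c1 \<noteq> c2" "cup_free w" "cup_free w0" "length w0 = length w"
    "crossings (n, w) = {p, q} \<union> crossings (n, w0)"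
    "p \<notin> crossings (n, w0)" "q \<notin> crossings (n, w0)"
    "oriented_res (n, w) = insert c1 (oriented_res (n, w0))"
    "circles (n, w) (insert c2 (oriented_res (n, w0))) =
       strand (length w) ` ({..<n} - {i, Suc i}) \<union>
         {outer_circle (length w) p q i, inner_circle p q i}"
    "letter_index (w ! p) = i"
proof -
  have site': "cup_free w" "p < q" "q < length w" "Suc i < n" "{w ! p, w ! q} = {Pos i, Neg i}"
    using site by (auto simp: second_move_site_def)
  have letters: "(w ! p = Neg i \<and> w ! q = Pos i) \<or> (w ! p = Pos i \<and> w ! q = Neg i)"
    using site'(5) by (auto simp: doubleton_eq_iff)
  have c: "{c1, c2} = {p, q}" "c1 \<noteq> c2" "w ! c1 = Neg i" "w ! c2 = Pos i"
    using letters site'(2) r2 by (auto split: if_splits)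
  have w0: "w0 ! k = (if k = p \<or> k = q then Straight else w ! k)" if "k < length w" for k
    using that site' by (auto simp: w0_def nth_list_update)
  have len: "length w0 = length w" by (simp add: w0_def)
  have set: "set w0 \<subseteq> insert Straight (set w)"
    using set_update_subset_insert[of w p Straight] set_update_subset_insert[of "w[p := Straight]" q Straight]
    by (auto simp: w0_def)
  then have cf0: "cup_free w0" using site'(1) by (auto simp: cup_free_def)
  have pq: "k = p \<or> k = q \<longleftrightarrow> k = c1 \<or> k = c2" for k using c(1) by auto
  have ltc: "c1 < length w" "c2 < length w" using c(1) site' by (auto simp: doubleton_eq_iff)
  have cr0: "k \<in> crossings (n, w0) \<longleftrightarrow> k \<in> crossings (n, w) \<and> k \<noteq> p \<and> k \<noteq> q" for k
    by (cases "k < length w") (auto simp: crossings_iff len w0)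
  have "p \<in> crossings (n, w)" "q \<in> crossings (n, w)"
    using letters site'(2,3) by (auto simp: crossings_iff)
  then have cr: "crossings (n, w) = {p, q} \<union> crossings (n, w0)" using cr0 by blast
  have notin: "p \<notin> crossings (n, w0)" "q \<notin> crossings (n, w0)" using cr0 by auto
  have or0: "k \<in> oriented_res (n, w0) \<longleftrightarrow> k \<in> oriented_res (n, w) \<and> k \<noteq> p \<and> k \<noteq> q" for k
    by (cases "k < length w") (auto simp: oriented_res_iff len w0)
  have ori: "oriented_res (n, w) = insert c1 (oriented_res (n, w0))"
  proof -
    have "c1 \<in> oriented_res (n, w)" "c2 \<notin> oriented_res (n, w)" using c ltc by (auto simp: oriented_res_iff)
    then show ?thesis using or0 pq by blast
  qed
  let ?s = "insert c2 (oriented_res (n, w0))"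
  have res: "resolve (c1 \<in> ?s) (w ! c1) = Cup i" "resolve (c2 \<in> ?s) (w ! c2) = Cup i"
    using c(2-4) or0 pq by auto
  have circ: "circles (n, w) ?s = strand (length w) ` ({..<n} - {i, Suc i}) \<union>
      {outer_circle (length w) p q i, inner_circle p q i}"
  proof (rule circles_two_cups)
    show "resolve (p \<in> ?s) (w ! p) = Cup i" "resolve (q \<in> ?s) (w ! q) = Cup i"
      using res c(1) by (metis insertCI insertE singletonD)+
    fix k assume k: "k < length w" "k \<noteq> p" "k \<noteq> q"
    then show "resolve (k \<in> ?s) (w ! k) = Straight"
      using site'(1) nth_mem[of k w] pq[of k] or0[of k]
      by (cases "w ! k") (auto simp: cup_free_def oriented_res_iff)
  qed (use site' in auto)
  show "letter_index (w ! p) = i" using letters by auto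
  show "{c1, c2} = {p, q}" "c1 \<noteq> c2" "cup_free w" "cup_free w0" "length w0 = length w"
    using c site' cf0 len by blast+
  show "crossings (n, w) = {p, q} \<union> crossings (n, w0)"
    "p \<notin> crossings (n, w0)" "q \<notin> crossings (n, w0)"
    "oriented_res (n, w) = insert c1 (oriented_res (n, w0))"
    "circles (n, w) ?s = strand (length w) ` ({..<n} - {i, Suc i}) \<union>
      {outer_circle (length w) p q i, inner_circle p q i}"
    using cr notin ori circ by blast+
qed

declare r2_crossings.simps [simp del]

lemma Psi2_component:
  assumes c: "r2_crossings D p q = (c1, c2)" "c1 \<noteq> c2"
  defines "D0 \<equiv> r2_result D p q"
  shows "\<not> s \<subseteq> crossings D \<Longrightarrow> Psi2 D p q z s = (\<lambda>_. 0)"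
    and "s \<inter> {p, q} \<noteq> {c1} \<Longrightarrow> s \<inter> {p, q} \<noteq> {c2} \<Longrightarrow> Psi2 D p q z s = (\<lambda>_. 0)"
    and "s \<subseteq> crossings D \<Longrightarrow> s \<inter> {p, q} = {c1} \<Longrightarrow>
      Psi2 D p q z s = (\<lambda>T. r2_sign D0 p (s - {p, q}) * z (s - {p, q}) T)"
    and "s \<subseteq> crossings D \<Longrightarrow> s \<inter> {p, q} = {c2} \<Longrightarrow>
      Psi2 D p q z s = (\<lambda>T. r2_sign D0 p (s - {p, q}) *
        birth (r2_small_circle D p s) (circles D s)
          (saddle (circles D0 (s - {p, q})) (circles D s - {r2_small_circle D p s}) (z (s - {p, q}))) T)"
  using c(2) unfolding Psi2_def D0_def by (simp_all add: c(1) Let_def fun_eq_iff)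

text \<open>
  The correction term of the second move, which is the obstruction for a chain on the oriented resolution
  to stay there: the two circles are merged, which multiplies their labels.
\<close>
lemma Psi2_cup_component:
  assumes site: "second_move_site n w p q i"
    and c: "r2_crossings (n, w) p q = (c1, c2)"
  defines "D0 \<equiv> (n, w[p := Straight, q := Straight])"
  defines "s \<equiv> insert c2 (oriented_res D0)"
  shows "Psi2 (n, w) p q (strand_state D0 l) s = pure_tensor (circles (n, w) s)
    (\<lambda>\<gamma>. if \<gamma> = inner_circle p q i then A_one
         else if \<gamma> = outer_circle (length w) p q i then A_mult (l i) (l (Suc i))
         else l (strand_index \<gamma>))"
proof -
  let ?w0 = "w[p := Straight, q := Straight]" and ?L = "length w"
  let ?R = "strand ?L ` ({..<n} - {i, Suc i})"
  let ?in = "inner_circle p q i" and ?out = "outer_circle ?L p q i"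
  note f = c second_move_site_facts[OF site c]
  have pq: "p < q" "q < ?L" "Suc i < n" using site by (auto simp: second_move_site_def)
  let ?r = "oriented_res D0"
  have r: "p \<notin> ?r" "q \<notin> ?r" "?r \<subseteq> crossings (n, w)"
    using oriented_res_subset[of D0] f(7-9) by (auto simp: D0_def)
  have s: "s \<subseteq> crossings (n, w)" "s - {p, q} = ?r" "s \<inter> {p, q} = {c2}"
    using r f(2,7) by (auto simp: s_def doubleton_eq_iff)
  have Q: "circles (n, w) s = ?R \<union> {?out, ?in}" using f(11) by (simp add: s_def D0_def)
  have P: "circles D0 ?r = {strand ?L i, strand ?L (Suc i)} \<union> ?R"
    using circles_oriented[OF f(5), of n] pq(3) by (auto simp: D0_def)
  have in_mem: "(Suc p, i) \<in> ?in" "(Suc p, i) \<notin> ?out"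
    using pq by (auto simp: inner_circle_def outer_circle_def)
  have out_mem: "(p, i) \<in> ?out" "(p, Suc i) \<in> ?out" using pq by (auto simp: outer_circle_def)
  have notR: "?in \<notin> ?R" "?out \<notin> ?R" "?in \<noteq> ?out"
    using in_mem out_mem by (auto simp: mem_strand_iff)
  have strands: "strand ?L i \<notin> ?R" "strand ?L (Suc i) \<notin> ?R" "strand ?L i \<noteq> strand ?L (Suc i)"
    "?out \<noteq> strand ?L i" "?out \<noteq> strand ?L (Suc i)"
    using out_mem by (auto simp: mem_strand_iff dest: arg_cong[where f = strand_index])
  have small: "r2_small_circle (n, w) p s = ?in"
    unfolding r2_small_circle_def circle_of_def Q snd_conv f(12)
  proof (rule the_equality)
    show "?in \<in> ?R \<union> {?out, ?in} \<and> (Suc p, i) \<in> ?in" using in_mem by simp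
    show "\<gamma> = ?in" if "\<gamma> \<in> ?R \<union> {?out, ?in} \<and> (Suc p, i) \<in> \<gamma>" for \<gamma>
      using that in_mem by (auto simp: mem_strand_iff)
  qed
  have rest: "circles (n, w) s - {?in} = insert ?out ?R" using notR by (auto simp: Q)
  have sign: "r2_sign D0 p ?r = 1" by (simp add: r2_sign_def mult_2[symmetric] power_mult)
  let ?lab = "\<lambda>\<gamma>. l (strand_index \<gamma>)"
  let ?\<alpha> = "?lab(?out := A_mult (l i) (l (Suc i)))"
  have "saddle (circles D0 ?r) (insert ?out ?R) (strand_state D0 l ?r) = pure_tensor (insert ?out ?R) ?\<alpha>"
    using saddle_pure_tensor[of ?R "strand ?L i" "strand ?L (Suc i)" ?out ?lab] strands notR
    by (simp add: strand_state_def pure_state_def P)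
  then have "Psi2 (n, w) p q (strand_state D0 l) s = birth ?in (circles (n, w) s) (pure_tensor (insert ?out ?R) ?\<alpha>)"
    unfolding Psi2_component(4)[OF f(1) f(3) s(1,3)] s(2) small rest
    by (simp add: sign flip: D0_def)
  also have "\<dots> = pure_tensor (circles (n, w) s) (?\<alpha>(?in := A_one))"
    unfolding rest[symmetric] by (rule birth_pure_tensor) (simp_all add: Q)
  also have "\<dots> = pure_tensor (circles (n, w) s)
    (\<lambda>\<gamma>. if \<gamma> = ?in then A_one else if \<gamma> = ?out then A_mult (l i) (l (Suc i)) else l (strand_index \<gamma>))"
    by (rule pure_tensor_cong) auto
  finally show ?thesis .
qed

lemma Psi2_cup_component_eq_0_iff:
  assumes site: "second_move_site n w p q i"
    and c: "r2_crossings (n, w) p q = (c1, c2)"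
  defines "D0 \<equiv> (n, w[p := Straight, q := Straight])"
  shows "Psi2 (n, w) p q (strand_state D0 l) (insert c2 (oriented_res D0)) = (\<lambda>_. 0) \<longleftrightarrow>
    A_mult (l i) (l (Suc i)) = 0 \<or> (\<exists>j<n. j \<noteq> i \<and> j \<noteq> Suc i \<and> l j = 0)"
proof -
  let ?L = "length w"
  have Q: "circles (n, w) (insert c2 (oriented_res D0)) =
       strand ?L ` ({..<n} - {i, Suc i}) \<union> {outer_circle ?L p q i, inner_circle p q i}"
    unfolding D0_def by (rule second_move_site_facts(10)[OF site c])
  have pq: "p < q" "q < ?L" using site by (auto simp: second_move_site_def)
  have "(Suc p, i) \<in> inner_circle p q i" "(Suc p, i) \<notin> outer_circle ?L p q i" "(p, i) \<in> outer_circle ?L p q i"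
     "(p, Suc i) \<in> outer_circle ?L p q i"
    using pq by (auto simp: inner_circle_def outer_circle_def)
  then have ne: "inner_circle p q i \<noteq> outer_circle ?L p q i" by metis
  have one: "A_one \<noteq> 0" by (simp add: A_one_def zero_prod_def)
  have other: "strand ?L j \<noteq> outer_circle ?L p q i" if "j \<noteq> i \<and> j \<noteq> Suc i" for j
    using \<open>(p, i) \<in> outer_circle ?L p q i\<close> that by (metis mem_strand_iff snd_conv)
  have other': "strand ?L j \<noteq> inner_circle p q i" if "j \<noteq> i \<and> j \<noteq> Suc i" for j
    using \<open>(Suc p, i) \<in> inner_circle p q i\<close> that by (metis mem_strand_iff snd_conv)
  show ?thesis
    unfolding D0_def Psi2_cup_component[OF site c]
    unfolding D0_def[symmetric] Q
    using ne one by (subst pure_tensor_eq_0_iff) (auto simp: other other' dest: other other')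
qed

text \<open>
  The only resolutions where the image could be nonzero are the oriented one and the one with the cups, and
  on the latter the label of the merged circle is zero.
\<close>
lemma Psi2_strand_state:
  assumes site: "second_move_site n w p q i" and zero: "A_mult (l i) (l (Suc i)) = 0"
  defines "D0 \<equiv> (n, w[p := Straight, q := Straight])"
  shows "Psi2 (n, w) p q (strand_state D0 l) = strand_state (n, w) l"
proof (intro ext)
  fix s T
  let ?w0 = "w[p := Straight, q := Straight]" and ?L = "length w" and ?r = "oriented_res D0"
  obtain c1 c2 where c: "r2_crossings (n, w) p q = (c1, c2)" by (cases "r2_crossings (n, w) p q")
  note f = c second_move_site_facts[OF site c, folded D0_def]
  have sub: "?r \<subseteq> crossings D0" by (rule oriented_res_subset)
  have D0: "strand_state D0 l r = (if r = ?r then pure_tensor (strand ?L ` {..<n}) (\<lambda>\<gamma>. l (strand_index \<gamma>)) else (\<lambda>_. 0))" for r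
    unfolding D0_def using strand_state_apply[OF f(5), of n l r] f(6) by simp
  have result: "r2_result (n, w) p q = D0" by (simp add: D0_def)
  have sign: "r2_sign D0 p ?r = 1" by (simp add: r2_sign_def mult_2[symmetric] power_mult)
  show "Psi2 (n, w) p q (strand_state D0 l) s T = strand_state (n, w) l s T"
  proof (cases "s \<subseteq> crossings (n, w)")
    case False
    then show ?thesis using oriented_res_subset[of "(n, w)"]
      by (auto simp: Psi2_component(1)[OF f(1,3)] strand_state_apply f(4))
  next
    case s: True
    have notin: "p \<notin> ?r" "q \<notin> ?r" using sub f(8,9) by auto
    have d: "insert c ?r - {p, q} = ?r" "insert c ?r \<inter> {p, q} = {c}" if "c \<in> {p, q}" for c
      using notin that by blast+
    have c12: "c1 \<in> {p, q}" "c2 \<in> {p, q}" using f(2) by blast+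
    have ori: "s \<noteq> oriented_res (n, w)" if "s - {p, q} \<noteq> ?r \<or> s \<inter> {p, q} \<noteq> {c1}"
      using that d[OF c12(1)] f(10) by auto
    consider "s - {p, q} \<noteq> ?r" | "s = insert c1 ?r" | "s = insert c2 ?r"
      | "s - {p, q} = ?r" "s \<inter> {p, q} \<noteq> {c1}" "s \<inter> {p, q} \<noteq> {c2}"
    proof (cases "s - {p, q} = ?r \<and> (s \<inter> {p, q} = {c1} \<or> s \<inter> {p, q} = {c2})")
      case True
      then have "s = insert c1 ?r \<or> s = insert c2 ?r" by (metis Int_Diff_Un Un_insert_left Un_empty_left)
      then show ?thesis using that by blast
    qed (use that in blast)
    then show ?thesis
    proof cases
      case 1
      then have "s \<noteq> oriented_res (n, w)" using ori by simp
      then have "strand_state (n, w) l s = (\<lambda>_. 0)" by (simp add: strand_state_apply f(4))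
      moreover have "strand_state D0 l (s - {p, q}) = (\<lambda>_. 0)" using 1 by (simp add: D0)
      ultimately show ?thesis
        using Psi2_component[OF f(1,3), of s "strand_state D0 l"] s
        by (cases "s \<inter> {p, q} = {c1} \<or> s \<inter> {p, q} = {c2}")
          (auto simp: saddle_zero birth_def local_map_zero)
    next
      case 2
      then have "s \<inter> {p, q} = {c1}" "s - {p, q} = ?r" using d[OF c12(1)] by auto
      then show ?thesis
        using 2 f(10) unfolding Psi2_component(3)[OF f(1,3) s \<open>s \<inter> {p, q} = {c1}\<close>] result
        by (simp add: D0 strand_state_apply f(4) sign)
    next
      case 3
      then have "s \<noteq> oriented_res (n, w)" using ori d(2)[OF c12(2)] f(3) by auto
      moreover have "Psi2 (n, w) p q (strand_state D0 l) s = (\<lambda>_. 0)"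
        using Psi2_cup_component_eq_0_iff[OF site f(1), of l] zero by (simp add: 3 D0_def)
      ultimately show ?thesis by (simp add: strand_state_apply f(4))
    next
      case 4
      then have "s \<noteq> oriented_res (n, w)" using ori by simp
      then show ?thesis using Psi2_component(2)[OF f(1,3) 4(2,3)]
        by (simp add: strand_state_apply f(4))
    qed
  qed
qed

text \<open>
  The map in this direction sees the cups only through the component of the chain on that resolution,
  which is zero; so this holds for arbitrary labels.
\<close>
lemma Phi2_strand_state:
  assumes site: "second_move_site n w p q i"
  defines "D0 \<equiv> (n, w[p := Straight, q := Straight])"
  shows "Phi2 (n, w) p q (strand_state (n, w) l) = strand_state D0 l"
proof (intro ext)
  fix r T
  let ?w0 = "w[p := Straight, q := Straight]" and ?L = "length w" and ?r = "oriented_res D0"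
  obtain c1 c2 where c: "r2_crossings (n, w) p q = (c1, c2)" by (cases "r2_crossings (n, w) p q")
  note f = c second_move_site_facts[OF site c, folded D0_def]
  have result: "r2_result (n, w) p q = D0" by (simp add: D0_def)
  have sign: "r2_sign D0 p ?r = 1" by (simp add: r2_sign_def mult_2[symmetric] power_mult)
  have sub: "?r \<subseteq> crossings D0" by (rule oriented_res_subset)
  have D0: "strand_state D0 l r = (if r = ?r then pure_tensor (strand ?L ` {..<n}) (\<lambda>\<gamma>. l (strand_index \<gamma>)) else (\<lambda>_. 0))" for r
    unfolding D0_def using strand_state_apply[OF f(5), of n l r] f(6) by simp
  show "Phi2 (n, w) p q (strand_state (n, w) l) r T = strand_state D0 l r T"
  proof (cases "r \<subseteq> crossings D0")
    case True
    have c1: "c1 \<in> {p, q}" using f(2) by blast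
    then have notin: "c1 \<notin> r" "c1 \<notin> ?r" using True sub f(8,9) by blast+
    have "insert c2 r \<noteq> oriented_res (n, w)" using f(3,10) notin by blast
    moreover have "insert c1 r = oriented_res (n, w) \<longleftrightarrow> r = ?r"
      unfolding f(10) by (rule insert_ident[OF notin])
    ultimately have y: "strand_state (n, w) l (insert c2 r) = (\<lambda>_. 0)"
      "strand_state (n, w) l (insert c1 r) = strand_state D0 l r"
      by (simp_all add: strand_state_apply[OF f(4)] D0)
    have "Phi2 (n, w) p q (strand_state (n, w) l) r T = r2_sign D0 p r * strand_state D0 l r T"
      using True by (simp add: Phi2_def f(1) result Let_def y death_def local_map_zero saddle_zero
          del: r2_result.simps)
    then show ?thesis by (cases "r = ?r") (simp_all add: sign D0)
  next
    case False
    then have "r \<noteq> ?r" using sub by blast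
    then show ?thesis using False by (simp add: Phi2_def f(1) result D0 del: r2_result.simps)
  qed
qed

section \<open>First moves\<close>
lemma circle_of_strand:
  assumes "j < n"
  shows "circle_of (strand L ` {..<n}) (0, j) = strand L j"
  unfolding circle_of_def
  by (rule the_equality) (use assms in \<open>auto simp: mem_strand_iff\<close>)

definition A_scale :: "'r \<Rightarrow> 'r \<times> 'r \<Rightarrow> 'r \<times> 'r" where
  "A_scale c a = (c * fst a, c * snd a)"

lemma stabilized_diagram:
  fixes w :: "letter list" and n :: nat
  assumes "cup_free w"
  defines "w' \<equiv> w @ [Pos (n - 1)]"
  shows "cup_free w'" "oriented_res (Suc n, w') = oriented_res (n, w)"
    "crossings (n, w) = crossings (Suc n, w') - {length w}"
    "strand (Suc (length w)) ` {..<Suc n} - {strand (Suc (length w)) n} = strand (Suc (length w)) ` {..<n}"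
proof -
  show "cup_free w'" using assms by (auto simp: cup_free_def)
  show "oriented_res (Suc n, w') = oriented_res (n, w)"
    by (auto simp: oriented_res_iff w'_def nth_append less_Suc_eq split: if_splits)
  show "crossings (n, w) = crossings (Suc n, w') - {length w}"
    by (auto simp: crossings_iff w'_def nth_append less_Suc_eq split: if_splits)
  show "strand (Suc (length w)) ` {..<Suc n} - {strand (Suc (length w)) n} = strand (Suc (length w)) ` {..<n}"
    by (auto simp: lessThan_Suc dest: arg_cong[where f = strand_index])
qed

text \<open>
  The identities \<open>x_circ \<otimes> (x_circ + x_bullet) - \<Delta> x_circ = x_circ \<otimes> x_bullet\<close> and
  \<open>x_bullet \<otimes> (x_circ + x_bullet) - \<Delta> x_bullet = x_bullet \<otimes> x_circ\<close>: the circle born in a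
  first move receives the other one of the two labels. Multiplying the first factor by a scalar
  multiplies both sides.
\<close>
lemma curl_pure_tensor:
  assumes ne: "\<gamma> \<noteq> \<omega>"
    and \<alpha>: "\<alpha> \<gamma> = A_scale c x_circ \<and> \<alpha> \<omega> = x_bullet \<or> \<alpha> \<gamma> = A_scale c x_bullet \<and> \<alpha> \<omega> = x_circ"
    and V: "V \<subseteq> {\<gamma>, \<omega>}"
  shows "(\<Sum>U\<in>Pow {\<gamma>}. (let a = basis (\<gamma> \<in> U) in
      tensor2 \<gamma> \<omega> a (x_circ + x_bullet) V - comult \<gamma> \<omega> a V) * pure_tensor {\<gamma>} \<alpha> U) =
    pure_tensor {\<gamma>, \<omega>} \<alpha> V"
proof -
  have ne': "\<omega> \<noteq> \<gamma>" using ne by simp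
  have "Pow {\<gamma>} = {{}, {\<gamma>}}" by (auto simp: Pow_insert)
  then have sum: "(\<Sum>U\<in>Pow {\<gamma>}. f U) = f {} + f {\<gamma>}" for f :: "circle set \<Rightarrow> 'r" by simp
  have t2: "tensor2 \<gamma> \<omega> a b V =
      (if \<gamma> \<in> V then snd a else fst a) * (if \<omega> \<in> V then snd b else fst b)" for a b
    using ne ne' V by (simp add: tensor2_def pure_tensor_def)
  have rhs: "pure_tensor {\<gamma>, \<omega>} \<alpha> V =
      (if \<gamma> \<in> V then snd (\<alpha> \<gamma>) else fst (\<alpha> \<gamma>)) * (if \<omega> \<in> V then snd (\<alpha> \<omega>) else fst (\<alpha> \<omega>))"
    using ne ne' V by (simp add: pure_tensor_def)
  have single: "pure_tensor {\<gamma>} \<alpha> {} = fst (\<alpha> \<gamma>)" "pure_tensor {\<gamma>} \<alpha> {\<gamma>} = snd (\<alpha> \<gamma>)"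
    by (simp_all add: pure_tensor_def)
  show ?thesis
    unfolding sum comult_def t2 rhs single Let_def
    using \<alpha>
    by (elim disjE conjE; cases "\<gamma> \<in> V"; cases "\<omega> \<in> V";
        simp add: basis_def A_X_def A_one_def x_circ_def x_bullet_def A_mult_def A_scale_def algebra_simps)
qed

lemma Phi1_strand_state:
  assumes w: "cup_free w" and n: "n \<ge> 1"
    and l: "l (n - 1) = A_scale c x_circ \<and> l n = x_bullet \<or> l (n - 1) = A_scale c x_bullet \<and> l n = x_circ"
  shows "Phi1 (n, w) (Suc n, w @ [Pos (n - 1)]) (strand_state (n, w) l) =
    strand_state (Suc n, w @ [Pos (n - 1)]) l"
proof (intro ext)
  fix s T
  let ?L = "length w" and ?w' = "w @ [Pos (n - 1)]"
  let ?D = "(n, w)" and ?D' = "(Suc n, ?w')"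
  note st = stabilized_diagram[OF w, of n, unfolded One_nat_def]
  let ?P = "strand (Suc ?L) ` {..<n}" and ?Q = "strand (Suc ?L) ` {..<Suc n}"
  let ?\<omega> = "strand (Suc ?L) n" and ?\<gamma> = "strand (Suc ?L) (n - 1)"
  let ?lab = "\<lambda>\<gamma>. l (strand_index \<gamma>)"
  show "Phi1 ?D ?D' (strand_state ?D l) s T = strand_state ?D' l s T"
  proof (cases "s = oriented_res ?D")
    case s: True
    have Q: "circles ?D' s = ?Q" "circles ?D s = strand ?L ` {..<n}"
      using circles_oriented[OF st(1), of "Suc n"] circles_oriented[OF w, of n] by (simp_all add: s st(2))
    note Q = Q[unfolded One_nat_def]
    have sub: "s \<subseteq> crossings ?D'" "?L \<notin> s"
      using oriented_res_subset[of ?D] unfolding s st(3) One_nat_def by blast+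
    have circ: "circle_of ?Q (0, n) = ?\<omega>" "circle_of ?Q (0, n - 1) = ?\<gamma>"
      by (rule circle_of_strand; use n in simp)+
    note circ = circ[unfolded One_nat_def]
    have trans: "transport (strand ?L ` {..<n}) ?P UNIV id (strand_state ?D l s) = pure_tensor ?P ?lab"
      unfolding s strand_state_apply[OF w] if_P[OF refl]
    proof (rule transport_strands)
      show "strand ?L j \<inter> UNIV \<noteq> {}" for j using strand_nonempty[of j] by blast
    qed (auto simp: mem_strand_iff)
    have \<gamma>\<omega>: "?\<gamma> \<noteq> ?\<omega>" using n by (auto dest: arg_cong[where f = strand_index])
    have Q': "?Q = insert ?\<omega> ?P" by (simp add: lessThan_Suc)
    have \<gamma>P: "?\<gamma> \<in> ?P" using n by simp
    have \<omega>P: "?\<omega> \<notin> ?P" using inj_strand[of "Suc ?L" UNIV] by (auto dest: injD)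
    have lab: "?lab ?\<gamma> = A_scale c x_circ \<and> ?lab ?\<omega> = x_bullet \<or>
        ?lab ?\<gamma> = A_scale c x_bullet \<and> ?lab ?\<omega> = x_circ"
      using l by simp
    have "local_map {?\<gamma>} {?\<gamma>, ?\<omega>} ?Q (\<lambda>U V. let a = basis (?\<gamma> \<in> U) in
        tensor2 ?\<gamma> ?\<omega> a (x_circ + x_bullet) V - comult ?\<gamma> ?\<omega> a V) (pure_tensor ?P ?lab) = pure_tensor ?Q ?lab"
    proof (rule local_map_pure_tensor)
      fix V assume "V \<subseteq> {?\<gamma>, ?\<omega>}"
      then show "(\<Sum>U\<in>Pow {?\<gamma>}. (let a = basis (?\<gamma> \<in> U) in
          tensor2 ?\<gamma> ?\<omega> a (x_circ + x_bullet) V - comult ?\<gamma> ?\<omega> a V) * pure_tensor {?\<gamma>} ?lab U) =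
        pure_tensor {?\<gamma>, ?\<omega>} ?lab V"
        by (rule curl_pure_tensor[of ?\<gamma> ?\<omega> ?lab c V, OF \<gamma>\<omega> lab])
    next
      show "{?\<gamma>, ?\<omega>} \<inter> (?P - {?\<gamma>}) = {}" "?Q = {?\<gamma>, ?\<omega>} \<union> (?P - {?\<gamma>})" "{?\<gamma>} \<subseteq> ?P"
        using Q' \<gamma>P \<omega>P by blast+
    qed auto
    then show ?thesis
      using sub by (simp add: Let_def Q circ st(4) trans strand_state_apply[OF st(1)] st(2) s[symmetric])
  next
    case False
    then show ?thesis
      by (simp add: strand_state_apply[OF st(1)] strand_state_apply[OF w] st(2) Let_def transport_zero local_map_zero)
  qed
qed

lemma Psi1_strand_state:
  assumes w: "cup_free w" and l: "counit (l n) = 1"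
  shows "Psi1 (Suc n, w @ [Pos (n - 1)]) (n, w) (strand_state (Suc n, w @ [Pos (n - 1)]) l) =
    strand_state (n, w) l"
proof (intro ext)
  fix s T
  let ?L = "length w" and ?w' = "w @ [Pos (n - 1)]"
  let ?D = "(n, w)" and ?D' = "(Suc n, ?w')"
  note st = stabilized_diagram[OF w, of n, unfolded One_nat_def]
  let ?P = "strand (Suc ?L) ` {..<n}" and ?Q = "strand (Suc ?L) ` {..<Suc n}"
  let ?\<omega> = "strand (Suc ?L) n"
  let ?lab = "\<lambda>\<gamma>. l (strand_index \<gamma>)"
  show "Psi1 ?D' ?D (strand_state ?D' l) s T = strand_state ?D l s T"
  proof (cases "s = oriented_res ?D")
    case s: True
    have Q: "circles ?D' s = ?Q" "circles ?D s = strand ?L ` {..<n}"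
      using circles_oriented[OF st(1), of "Suc n"] circles_oriented[OF w, of n] by (simp_all add: s st(2))
    note Q = Q[unfolded One_nat_def]
    have sub: "s \<subseteq> crossings ?D"
      using oriented_res_subset[of ?D] s by blast
    have circ: "circle_of ?Q (0, n) = ?\<omega>" by (rule circle_of_strand) simp
    have "death ?\<omega> (?Q - {?\<omega>}) (pure_tensor ?Q ?lab) = pure_tensor (?Q - {?\<omega>}) ?lab"
      by (rule death_pure_tensor) (use l in auto)
    then have death: "death ?\<omega> ?P (pure_tensor ?Q ?lab) = pure_tensor ?P ?lab" by (simp only: st(4))
    have trans: "transport ?P (strand ?L ` {..<n}) UNIV (\<lambda>(j, i). (j mod ?L, i)) (pure_tensor ?P ?lab) =
        pure_tensor (strand ?L ` {..<n}) ?lab"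
    proof (rule transport_strands)
      show "strand (Suc ?L) j \<inter> UNIV \<noteq> {}" for j using strand_nonempty[of j] by blast
      show "(case p of (j, i) \<Rightarrow> (j mod ?L, i)) \<in> strand ?L j" if "p \<in> strand (Suc ?L) j" for j p
        using that by (cases "?L = 0"; cases p) (auto simp: mem_strand_iff less_max_iff_disj)
    qed
    show ?thesis
      using sub by (simp add: Let_def Q circ st(4) death trans strand_state_apply[OF st(1)] strand_state_apply[OF w] st(2)
          s[symmetric])
  next
    case False
    then show ?thesis
      by (simp add: strand_state_apply[OF st(1)] strand_state_apply[OF w] st(2) Let_def transport_zero
          local_map_zero death_def)
  qed
qed

section \<open>Third moves\<close>
lemma differential_at_zero: "differential_at D c (\<lambda>_ _. 0) = (\<lambda>_ _. 0)"
  by (simp add: differential_at_def saddle_zero fun_eq_iff)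

text \<open>
  The \<open>0\<close>-resolution of a positive crossing is straight, so smoothing the middle crossing of a third move does not
  change the oriented resolution.
\<close>
lemma straighten_positive:
  assumes "cup_free w" "k < length w" "w ! k = Pos i"
  shows "strand_state (n, w[k := Straight]) l = strand_state (n, w) l" "cup_free (w[k := Straight])"
proof -
  show cf: "cup_free (w[k := Straight])"
    using assms(1) set_update_subset_insert[of w k Straight] by (auto simp: cup_free_def)
  have "oriented_res (n, w[k := Straight]) = oriented_res (n, w)"
    using assms by (auto simp: oriented_res_iff nth_list_update split: if_splits)
  then show "strand_state (n, w[k := Straight]) l = strand_state (n, w) l"
    using strand_state_apply[OF cf, of n l] strand_state_apply[OF assms(1), of n l]
    by (simp add: fun_eq_iff)
qed

text \<open>
  With the middle crossing smoothed, both sides of the move come from the same diagram of straight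
  strands by second moves \<open>g\<close> and \<open>g'\<close>, and the chains are \<open>g u\<close> and \<open>g' u\<close> for the state \<open>u\<close> of the
  straight strands. The move sends \<open>g u\<close> to \<open>(u, S (h (g u)))\<close> in the cone, where \<open>h g = 0\<close>, and from there to
  \<open>g' u\<close>.
\<close>
lemma r3_map_strand_state:
  assumes w: "cup_free w" "Suc k < length w" "w ! Suc k = Pos m"
    and w': "cup_free w'" "Suc k < length w'" "w' ! Suc k = Pos m'"
    and site: "second_move_site n (w[Suc k := Straight]) k (k + 2) i"
    and site': "second_move_site n (w'[Suc k := Straight]) k (k + 2) i'"
    and same: "w[Suc k := Straight, k := Straight, k + 2 := Straight] =
      w'[Suc k := Straight, k := Straight, k + 2 := Straight]"
    and zero: "\<And>j. A_mult (l j) (l (Suc j)) = 0"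
    and hom: "r3_homotopy (smooth_middle (n, w) k) k (k + 2) (H (smooth_middle (n, w) k) k)"
  shows "r3_map H (n, w) (n, w') k (strand_state (n, w) l) = strand_state (n, w') l"
proof -
  let ?D0 = "(n, w[Suc k := Straight])" and ?D0' = "(n, w'[Suc k := Straight])"
  let ?Ds = "(n, w[Suc k := Straight, k := Straight, k + 2 := Straight])"
  let ?z = "strand_state (n, w) l" and ?u = "strand_state ?Ds l"
  have z: "strand_state ?D0 l = ?z" "strand_state ?D0' l = strand_state (n, w') l"
    using straighten_positive[OF w] straighten_positive[OF w'] by blast+
  have Psi: "Psi2 ?D0 k (k + 2) ?u = ?z"
    using Psi2_strand_state[OF site, of l] zero by (simp only: z)
  have Psi': "Psi2 ?D0' k (k + 2) ?u = strand_state (n, w') l"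
    using Psi2_strand_state[OF site', of l] zero by (simp only: z same)
  have Phi: "Phi2 ?D0 k (k + 2) ?z = ?u"
    using Phi2_strand_state[OF site, of l] by (simp only: z)
  have notin: "Suc k \<notin> oriented_res (n, w)" using w by (simp add: oriented_res_iff)
  have z0: "(\<lambda>r T. if Suc k \<in> r then 0 else ?z r T) = ?z" "(\<lambda>r T. if Suc k \<in> r then ?z r T else 0) = (\<lambda>_ _. 0)"
    using notin by (auto simp: fun_eq_iff strand_state_apply w(1))
  have "r2_result ?D0 k (k + 2) = ?Ds" by simp
  then have "H ?D0 k (Psi2 ?D0 k (k + 2) ?u) = (\<lambda>_ _. 0)"
    using hom strand_state_in_chains[of ?Ds l] by (auto simp: r3_homotopy_def)
  then have H0: "H ?D0 k ?z = (\<lambda>_ _. 0)" by (simp only: Psi)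
  have "to_cone H (n, w) k ?z = (?u, \<lambda>_ _. 0)"
    using Phi H0 by (simp add: to_cone_def Let_def z0 differential_at_zero chain_add_def)
  then show ?thesis
    using Psi' by (simp add: r3_map_def cone_iso_def from_cone_def transport_zero chain_add_def cong: if_cong)
qed

end

section \<open>Planar isotopies of closures\<close>

lemma cup_free_simps [simp]:
  "cup_free (u @ v) \<longleftrightarrow> cup_free u \<and> cup_free v"
  "cup_free (a # v) \<longleftrightarrow> (\<forall>i. a \<noteq> Cup i) \<and> cup_free v"
  "cup_free []"
  by (auto simp: cup_free_def)

text \<open>
  The isotopies below remove or insert straight letters, on which the map of positions need not be
  injective; only the positions of crossings have to correspond.
\<close>
lemma bij_betw_crossings:
  assumes "\<And>c. c < length w \<Longrightarrow> \<exists>i. w ! c = Pos i \<or> w ! c = Neg i \<Longrightarrow>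
      \<pi> c < length w' \<and> w' ! \<pi> c = w ! c \<and> \<pi>' (\<pi> c) = c"
    and "\<And>c. c < length w' \<Longrightarrow> \<exists>i. w' ! c = Pos i \<or> w' ! c = Neg i \<Longrightarrow>
      \<pi>' c < length w \<and> w ! \<pi>' c = w' ! c \<and> \<pi> (\<pi>' c) = c"
  shows "bij_betw \<pi> (crossings (n, w)) (crossings (n, w'))"
    "c \<in> crossings (n, w) \<Longrightarrow> w' ! \<pi> c = w ! c"
proof -
  show "bij_betw \<pi> (crossings (n, w)) (crossings (n, w'))"
    by (rule bij_betw_byWitness[of _ \<pi>']) (use assms in \<open>auto simp: crossings_iff\<close>)
qed (use assms in \<open>auto simp: crossings_iff\<close>)

context frobenius_algebra
begin

lemma insert_straight_strand_state:
  assumes "cup_free (u @ v)"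
  shows "insert_straight (n, u @ v) (n, u @ [Straight, Straight] @ v) (length u)
      (strand_state (n, u @ v) l) = strand_state (n, u @ [Straight, Straight] @ v) l"
proof -
  let ?\<pi> = "\<lambda>c. if c < length u then c else c + 2"
  note b = bij_betw_crossings[of "u @ v" ?\<pi> "u @ [Straight, Straight] @ v" "\<lambda>c. if c < length u then c else c - 2"]
  have nth: "(u @ [Straight, Straight] @ v) ! c = (if c < length u then u ! c
      else if c < length u + 2 then Straight else v ! (c - length u - 2))"
    if "c < length u + length v + 2" for c
  proof -
    consider "c < length u" | "c = length u" | "c = Suc (length u)" | "c \<ge> length u + 2" by linarith
    then show ?thesis by cases (auto simp: nth_append nth_Cons')
  qed
  show ?thesis
    unfolding insert_straight_def
  proof (rule isotopy_strand_state)
    show "bij_betw ?\<pi> (crossings (n, u @ v)) (crossings (n, u @ [Straight, Straight] @ v))"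
      by (rule b(1)) (auto simp: nth nth_append[of u v] simp del: append_Cons split: if_splits)
    show "(u @ [Straight, Straight] @ v) ! ?\<pi> c = (u @ v) ! c" if "c \<in> crossings (n, u @ v)" for c
      using that by (auto simp: nth nth_append[of u v] crossings_iff simp del: append_Cons)
    show "strand (length (u @ v)) j \<inter> UNIV \<noteq> {}" for j using strand_nonempty[of j] by blast
  qed (use assms in \<open>auto simp: mem_strand_iff\<close>)
qed

lemma remove_straight_strand_state:
  assumes "cup_free (u @ v)"
  shows "remove_straight (n, u @ [Straight, Straight] @ v) (n, u @ v) (length u)
      (strand_state (n, u @ [Straight, Straight] @ v) l) = strand_state (n, u @ v) l"
proof -
  let ?\<pi> = "\<lambda>c. if c < length u then c else c - 2"
  note b = bij_betw_crossings[of "u @ [Straight, Straight] @ v" ?\<pi> "u @ v" "\<lambda>c. if c < length u then c else c + 2"]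
  have nth: "(u @ [Straight, Straight] @ v) ! c = (if c < length u then u ! c
      else if c < length u + 2 then Straight else v ! (c - length u - 2))"
    if "c < length u + length v + 2" for c
  proof -
    consider "c < length u" | "c = length u" | "c = Suc (length u)" | "c \<ge> length u + 2" by linarith
    then show ?thesis by cases (auto simp: nth_append nth_Cons')
  qed
  show ?thesis
    unfolding remove_straight_def
  proof (rule isotopy_strand_state)
    show "bij_betw ?\<pi> (crossings (n, u @ [Straight, Straight] @ v)) (crossings (n, u @ v))"
      by (rule b(1)) (auto simp: nth nth_append[of u v] simp del: append_Cons split: if_splits)
    show "(u @ v) ! ?\<pi> c = (u @ [Straight, Straight] @ v) ! c"
      if "c \<in> crossings (n, u @ [Straight, Straight] @ v)" for c
      using that by (auto simp: nth nth_append[of u v] crossings_iff simp del: append_Cons split: if_splits)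
    show "strand (length (u @ [Straight, Straight] @ v)) j \<inter> {(j, i). j \<noteq> Suc (length u)} \<noteq> {}" for j
      using strand_nonempty[of j] by fastforce
    show "(case p of (j, i) \<Rightarrow> ((if j \<le> length u then j else j - 2) mod length (snd (n, u @ v)), i))
        \<in> strand (length (u @ v)) j"
      if "p \<in> strand (length (u @ [Straight, Straight] @ v)) j" "p \<in> {(j, i). j \<noteq> Suc (length u)}" for j p
      using that by (cases "u @ v = []"; cases p) (auto simp: mem_strand_iff less_max_iff_disj)
  qed (use assms in auto)
qed

lemma commute_strand_state:
  assumes "cup_free (u @ [a, b] @ v)"
  shows "isotopy (n, u @ [a, b] @ v) (n, u @ [b, a] @ v) (transpose (length u) (length u + 1))
      {(j, i). j \<noteq> length u + 1} id (strand_state (n, u @ [a, b] @ v) l) =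
    strand_state (n, u @ [b, a] @ v) l"
proof (rule isotopy_strand_state)
  let ?\<pi> = "transpose (length u) (length u + 1)"
  have \<pi>: "?\<pi> c < length (u @ [a, b] @ v)" "(u @ [b, a] @ v) ! ?\<pi> c = (u @ [a, b] @ v) ! c"
    if "c < length (u @ [a, b] @ v)" for c a b
  proof -
    consider "c < length u" | "c = length u" | "c = Suc (length u)" | "c \<ge> length u + 2" by linarith
    then show "(u @ [b, a] @ v) ! ?\<pi> c = (u @ [a, b] @ v) ! c"
      by cases (auto simp: nth_append nth_Cons' transpose_def)
    show "?\<pi> c < length (u @ [a, b] @ v)" using that by (auto simp: transpose_def)
  qed
  show "bij_betw ?\<pi> (crossings (n, u @ [a, b] @ v)) (crossings (n, u @ [b, a] @ v))"
    by (rule bij_betw_crossings(1)[of _ _ _ ?\<pi>]) (use \<pi>[of _ a b] \<pi>[of _ b a] in auto)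
  show "(u @ [b, a] @ v) ! ?\<pi> c = (u @ [a, b] @ v) ! c" if "c \<in> crossings (n, u @ [a, b] @ v)" for c
    using \<pi>[of c a b] that by (auto simp: crossings_iff)
  show "strand (length (u @ [a, b] @ v)) j \<inter> {(j, i). j \<noteq> length u + 1} \<noteq> {}" for j
    using strand_nonempty[of j] by fastforce
qed (use assms in \<open>auto simp: mem_strand_iff\<close>)

lemma rotate_strand_state:
  assumes "cup_free (a # u)"
  defines "m \<equiv> length (a # u)"
  shows "isotopy (n, a # u) (n, u @ [a]) (\<lambda>c. (c + m - 1) mod m) UNIV (\<lambda>(j, i). ((j + m - 1) mod m, i))
      (strand_state (n, a # u) l) = strand_state (n, u @ [a]) l"
    and "isotopy (n, u @ [a]) (n, a # u) (\<lambda>c. (c + 1) mod m) UNIV (\<lambda>(j, i). ((j + 1) mod m, i))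
      (strand_state (n, u @ [a]) l) = strand_state (n, a # u) l"
proof -
  have m: "m > 0" "length (a # u) = m" "length (u @ [a]) = m" by (simp_all add: m_def)
  have down: "(c + m - 1) mod m = (if c = 0 then m - 1 else c - 1)" if "c < m" for c
    using that by (cases c) (auto simp: mod_if)
  have up: "(c + 1) mod m = (if c = m - 1 then 0 else c + 1)" if "c < m" for c
    using that by (auto simp: mod_if)
  have nth: "(u @ [a]) ! c = (if c = m - 1 then a else u ! c)" if "c < m" for c
    using that by (auto simp: m_def nth_append)
  have d: "(c + m - 1) mod m < m \<and> (u @ [a]) ! ((c + m - 1) mod m) = (a # u) ! c \<and>
      ((c + m - 1) mod m + 1) mod m = c" if c: "c < m" for c
  proof (cases "c = 0")
    case True
    then have x: "(c + m - 1) mod m = m - 1" using down[OF c] by simp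
    show ?thesis unfolding x using up[of "m - 1"] m(1) nth[of "m - 1"] True by simp
  next
    case False
    then have x: "(c + m - 1) mod m = c - 1" using down[OF c] by simp
    show ?thesis unfolding x using up[of "c - 1"] nth[of "c - 1"] c False by (auto simp: nth_Cons')
  qed
  have e: "(c + 1) mod m < m \<and> (a # u) ! ((c + 1) mod m) = (u @ [a]) ! c \<and>
      ((c + 1) mod m + m - 1) mod m = c" if c: "c < m" for c
  proof (cases "c = m - 1")
    case True
    then have x: "(c + 1) mod m = 0" using up[OF c] by simp
    show ?thesis unfolding x using down[of 0] m(1) nth[OF c] True by simp
  next
    case False
    then have x: "(c + 1) mod m = c + 1" using up[OF c] by simp
    have "c + 1 < m" using c False by linarith
    then show ?thesis unfolding x using down[of "c + 1"] nth[OF c] False by simp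
  qed
  have ne: "strand m j \<inter> UNIV \<noteq> {}" for j using strand_nonempty[of j] by blast
  show "isotopy (n, a # u) (n, u @ [a]) (\<lambda>c. (c + m - 1) mod m) UNIV (\<lambda>(j, i). ((j + m - 1) mod m, i))
      (strand_state (n, a # u) l) = strand_state (n, u @ [a]) l"
  proof (rule isotopy_strand_state)
    show "bij_betw (\<lambda>c. (c + m - 1) mod m) (crossings (n, a # u)) (crossings (n, u @ [a]))"
      by (rule bij_betw_crossings(1)[of _ _ _ "\<lambda>c. (c + 1) mod m"]) (use d e m in metis)+
    show "(u @ [a]) ! ((c + m - 1) mod m) = (a # u) ! c" if "c \<in> crossings (n, a # u)" for c
      using that d m unfolding crossings_iff by metis
  qed (use assms m ne in \<open>auto simp: mem_strand_iff less_max_iff_disj simp del: length_Cons length_append\<close>)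
  show "isotopy (n, u @ [a]) (n, a # u) (\<lambda>c. (c + 1) mod m) UNIV (\<lambda>(j, i). ((j + 1) mod m, i))
      (strand_state (n, u @ [a]) l) = strand_state (n, a # u) l"
  proof (rule isotopy_strand_state)
    show "bij_betw (\<lambda>c. (c + 1) mod m) (crossings (n, u @ [a])) (crossings (n, a # u))"
      by (rule bij_betw_crossings(1)[of _ _ _ "\<lambda>c. (c + m - 1) mod m"]) (use d e m in metis)+
    show "(a # u) ! ((c + 1) mod m) = (u @ [a]) ! c" if "c \<in> crossings (n, u @ [a])" for c
      using that e m unfolding crossings_iff by metis
  qed (use assms m ne in \<open>auto simp: mem_strand_iff less_max_iff_disj simp del: length_Cons length_append\<close>)
qed

section \<open>Alternating labels are preserved by all moves\<close>

text \<open>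
  For \<open>e = False\<close> and \<open>e = True\<close> these are the labels of \<open>\<beta>\<close> and of its conjugate.
\<close>
definition parity_label :: "bool \<Rightarrow> nat \<Rightarrow> 'r \<times> 'r" where
  "parity_label e j = (if even j = e then x_bullet else x_circ)"

text \<open>
  A scalar multiple of a pure tensor is again a pure tensor, with the scalar absorbed in one label. The
  outermost strand is used for this, as it is the only one which is present in every braid.
\<close>
definition alternating :: "'r \<Rightarrow> bool \<Rightarrow> nat \<Rightarrow> 'r \<times> 'r" where
  "alternating c e j = A_scale (if j = 0 then c else 1) (parity_label e j)"

lemma alternating_mult: "A_mult (alternating c e j) (alternating c e (Suc j)) = 0"
  by (auto simp: alternating_def parity_label_def A_scale_def A_mult_def x_circ_def x_bullet_def A_X_def zero_prod_def algebra_simps)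

lemma braid_diagram:
  obtains n w where "closure_diagram B = (n, w)" "n \<ge> 1" "cup_free w"
    "\<forall>a \<in> set w. \<exists>i. Suc i < n \<and> (a = Pos i \<or> a = Neg i)"
proof -
  obtain n w where D: "closure_diagram B = (n, w)" by (cases "closure_diagram B")
  then have "n \<ge> 1 \<and> (\<forall>a \<in> set w. \<exists>i. Suc i < n \<and> (a = Pos i \<or> a = Neg i))"
    using Rep_braid[of B] by (auto simp: closure_diagram_def)
  then show ?thesis using that D by (fastforce simp: cup_free_def)
qed

lemma letter_append_pair:
  "(u @ [a, b] @ v) ! length u = a" "(u @ [a, b] @ v) ! Suc (length u) = b"
  "(u @ [a, b] @ v)[length u := c, Suc (length u) := d] = u @ [c, d] @ v"
  by (simp_all add: nth_append list_update_append)

lemma second_move_site_pair: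
  assumes "cup_free (u @ [a, b] @ v)" "{a, b} = {Pos i, Neg i}" "Suc i < n"
  shows "second_move_site n (u @ [a, b] @ v) (length u) (length u + 1) i"
  using assms unfolding second_move_site_def by (auto simp: nth_append)

lemma second_move_site_triple:
  assumes "cup_free (u @ [a, c, b] @ v)" "{a, b} = {Pos i, Neg i}" "Suc i < n"
  shows "second_move_site n ((u @ [a, c, b] @ v)[Suc (length u) := Straight]) (length u) (length u + 2) i"
    and "(u @ [a, c, b] @ v)[Suc (length u) := Straight, length u := Straight, length u + 2 := Straight] =
      u @ [Straight, Straight, Straight] @ v"
    and "Suc (length u) < length (u @ [a, c, b] @ v)" "(u @ [a, c, b] @ v) ! Suc (length u) = c"
proof -
  have upd: "(u @ [a, c, b] @ v)[Suc (length u) := Straight] = u @ [a, Straight, b] @ v"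
    by (simp add: list_update_append)
  have nth: "(u @ [a, Straight, b] @ v) ! k = Straight" if "length u < k" "k < length u + 2" for k
  proof -
    have "k = Suc (length u)" using that by linarith
    then show ?thesis by (simp add: nth_append)
  qed
  show "second_move_site n ((u @ [a, c, b] @ v)[Suc (length u) := Straight]) (length u) (length u + 2) i"
    using assms nth unfolding upd second_move_site_def by (auto simp: nth_append)
  show "(u @ [a, c, b] @ v)[Suc (length u) := Straight, length u := Straight, length u + 2 := Straight] =
      u @ [Straight, Straight, Straight] @ v"
    unfolding upd by (simp add: list_update_append)
qed (simp_all add: nth_append)

lemma create_strand_state:
  assumes "cup_free (u @ [a, b] @ v)" "{a, b} = {Pos i, Neg i}" "Suc i < n"
    and "A_mult (l i) (l (Suc i)) = 0"
  shows "move_map H (R2_Create (length u)) (n, u @ v) (n, u @ [a, b] @ v) (strand_state (n, u @ v) l) =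
    strand_state (n, u @ [a, b] @ v) l"
  using insert_straight_strand_state[of u v n l] assms
    Psi2_strand_state[of n "u @ [a, b] @ v" "length u" "length u + 1" i l]
    second_move_site_pair[OF assms(1-3)] letter_append_pair(3)[of u a b v Straight Straight]
  by simp

lemma cancel_strand_state:
  assumes "cup_free (u @ [a, b] @ v)" "{a, b} = {Pos i, Neg i}" "Suc i < n"
  shows "move_map H (R2_Cancel (length u)) (n, u @ [a, b] @ v) (n, u @ v)
      (strand_state (n, u @ [a, b] @ v) l) = strand_state (n, u @ v) l"
  using remove_straight_strand_state[of u v n l] assms
    Phi2_strand_state[of n "u @ [a, b] @ v" "length u" "length u + 1" i l]
    second_move_site_pair[OF assms] letter_append_pair(3)[of u a b v Straight Straight]
  by simp

lemma third_move_strand_state: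
  assumes "cup_free (u @ [a, Pos m, b] @ v)" "{a, b} = {Pos i, Neg i}" "Suc i < n"
    and "cup_free (u @ [a', Pos m', b'] @ v)" "{a', b'} = {Pos i', Neg i'}" "Suc i' < n"
    and zero: "\<And>j. A_mult (l j) (l (Suc j)) = 0"
    and hom: "r3_homotopy (smooth_middle (n, u @ [a, Pos m, b] @ v) (length u)) (length u) (length u + 2)
      (H (smooth_middle (n, u @ [a, Pos m, b] @ v) (length u)) (length u))"
  shows "r3_map H (n, u @ [a, Pos m, b] @ v) (n, u @ [a', Pos m', b'] @ v) (length u)
      (strand_state (n, u @ [a, Pos m, b] @ v) l) = strand_state (n, u @ [a', Pos m', b'] @ v) l"
proof -
  note t = second_move_site_triple[OF assms(1-3)]
  note t' = second_move_site_triple[OF assms(4-6)]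
  show ?thesis
    by (rule r3_map_strand_state[where l = l and H = H, OF assms(1) t(3,4) assms(4) t'(3,4) t(1) t'(1) t(2)[folded t'(2)] zero hom])
qed

text \<open>
  The new strand \<open>n\<close> is not the outermost one, so its label is monic even if strand \<open>n - 1\<close> carries
  the scalar.
\<close>
lemma alternating_stabilized:
  assumes "n \<ge> 1"
  shows "\<exists>c'. alternating c e (n - 1) = A_scale c' x_circ \<and> alternating c e n = x_bullet \<or>
    alternating c e (n - 1) = A_scale c' x_bullet \<and> alternating c e n = x_circ"
  and "counit (alternating c e n) = 1"
  using assms by (cases n; auto simp: alternating_def parity_label_def A_scale_def counit_def x_circ_def x_bullet_def A_X_def)+

text \<open>
  Both directions of every move are covered, the creation and the cancellation of two crossings being separate
  moves. Creation and third moves use that adjacent labels multiply to zero.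
\<close>
theorem move_map_alternating:
  assumes move: "braid_move \<mu> B B'" and H: "homotopy_choice H"
  shows "move_map H \<mu> (closure_diagram B) (closure_diagram B')
      (strand_state (closure_diagram B) (alternating c e)) = strand_state (closure_diagram B') (alternating c e)"
proof -
  let ?D = "closure_diagram B" and ?D' = "closure_diagram B'" and ?l = "alternating c e"
  have ap: "applies \<mu> ?D ?D'" using move by (simp add: braid_move_def)
  obtain n w where D: "?D = (n, w)" "n \<ge> 1" "cup_free w"
    "\<forall>a \<in> set w. \<exists>i. Suc i < n \<and> (a = Pos i \<or> a = Neg i)" by (rule braid_diagram[of B])
  obtain n' w' where D': "?D' = (n', w')" "n' \<ge> 1" "cup_free w'"
    "\<forall>a \<in> set w'. \<exists>i. Suc i < n' \<and> (a = Pos i \<or> a = Neg i)" by (rule braid_diagram[of B'])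
  have index: "Suc i < n" if "Pos i \<in> set w" for i using bspec[OF D(4) that] by auto
  have index': "Suc i < n'" if "Pos i \<in> set w'" for i using bspec[OF D'(4) that] by auto
  have r3: "r3_homotopy (smooth_middle ?D k) k (k + 2) (H (smooth_middle ?D k) k)" if "\<mu> = R3 k" for k
    using H move that by (auto simp: homotopy_choice_def Let_def)
  note zero = alternating_mult[of c e]
  have "move_map H \<mu> (n, w) (n', w') (strand_state (n, w) ?l) = strand_state (n', w') ?l"
    using ap[unfolded D(1) D'(1)]
  proof cases
    case (create a b i u v)
    then have "Suc i < n'" using index'[of i] by (auto simp: doubleton_eq_iff)
    then show ?thesis
      using create create_strand_state[of u a b v i n' ?l H] D'(3) zero by simp
  next
    case (cancel a b i u v)
    then have "Suc i < n" using index[of i] by (auto simp: doubleton_eq_iff)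
    then show ?thesis
      using cancel cancel_strand_state[of u a b v i n H ?l] D(3) by simp
  next
    case (commute a i b j u v)
    then show ?thesis using commute_strand_state[of u a b v n ?l] D(3) by simp
  next
    case (R3 u i v)
    have i: "Suc i < n" "Suc (Suc i) < n" using index[of i] index[of "Suc i"] R3 by auto
    have "r3_map H (n, w) (n, w') (length u) (strand_state (n, w) ?l) = strand_state (n, w') ?l"
      using third_move_strand_state[of u "Neg (Suc i)" i "Pos (Suc i)" v "Suc i" n "Pos i" "Suc i" "Neg i" i ?l H]
        i D(1,3) D'(3) R3 zero r3[of "length u"] by (simp add: insert_commute)
    then show ?thesis using R3 by simp
  next
    case (R3_inverse u i v)
    have i: "Suc i < n" "Suc (Suc i) < n" using index[of i] index[of "Suc i"] R3_inverse by auto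
    have "r3_map H (n, w) (n, w') (length u) (strand_state (n, w) ?l) = strand_state (n, w') ?l"
      using third_move_strand_state[of u "Pos i" "Suc i" "Neg i" v i n "Neg (Suc i)" i "Pos (Suc i)" "Suc i" ?l H]
        i D(1,3) D'(3) R3_inverse zero r3[of "length u"] by (simp add: insert_commute)
    then show ?thesis using R3_inverse by simp
  next
    case (rotate a u)
    then show ?thesis using rotate_strand_state(1)[of a u n ?l] D(3) by (simp add: Let_def)
  next
    case (unrotate u a)
    then show ?thesis using rotate_strand_state(2)[of a u n ?l] D(3) by (simp add: Let_def)
  next
    case stabilize
    obtain c' where c': "?l (n - 1) = A_scale c' x_circ \<and> ?l n = x_bullet \<or>
        ?l (n - 1) = A_scale c' x_bullet \<and> ?l n = x_circ"
      using alternating_stabilized(1)[OF D(2)] by blast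
    then show ?thesis using stabilize Phi1_strand_state[OF D(3,2), of ?l c'] by simp
  next
    case destabilize
    then show ?thesis
      using Psi1_strand_state[OF D'(3), of ?l n'] alternating_stabilized(2)[OF D'(2)] by simp
  qed
  then show ?thesis by (simp only: D(1) D'(1))
qed

end

section \<open>The beta-cycles\<close>

text \<open>
  The strands run upwards and the closing arcs lie on the right, so the ray to the left of strand \<open>j\<close> meets
  exactly the strands \<open>0, \<dots>, j - 1\<close>.
\<close>
lemma nesting_strand:
  assumes "cup_free w" "j < n"
  shows "nesting (n, w) (strand (length w) j) = j"
proof -
  let ?L = "length w"
  define p where "p = (SOME p. p \<in> strand ?L j)"
  have "p \<in> strand ?L j" unfolding p_def using strand_nonempty by (rule someI)
  then have p: "fst p < max 1 ?L" "snd p = j" by (auto simp: mem_strand_iff)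
  have "{p' \<in> \<Union> (strand ?L ` {..<n}). fst p' = fst p \<and> snd p' < snd p} = {fst p} \<times> {..<j}"
    using p assms(2) by (auto simp: mem_strand_iff)
  then show ?thesis
    by (simp add: nesting_def circles_oriented[OF assms(1)] p_def[symmetric] Let_def)
qed

context frobenius_algebra
begin

lemma strand_state_scale:
  assumes "cup_free w"
  shows "strand_state (n, w) (\<lambda>j. A_scale (c j) (v j)) = scale (\<Prod>j<n. c j) (strand_state (n, w) v)"
proof (intro ext)
  fix r T
  have "pure_tensor (strand (length w) ` {..<n}) (\<lambda>\<gamma>. A_scale (c (strand_index \<gamma>)) (v (strand_index \<gamma>))) T =
      (\<Prod>j<n. c j) * pure_tensor (strand (length w) ` {..<n}) (\<lambda>\<gamma>. v (strand_index \<gamma>)) T"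
    unfolding A_scale_def pure_tensor_scale by (simp add: prod.reindex[OF inj_strand])
  then show "strand_state (n, w) (\<lambda>j. A_scale (c j) (v j)) r T = scale (\<Prod>j<n. c j) (strand_state (n, w) v) r T"
    by (simp add: strand_state_apply[OF assms] scale_def)
qed

lemma strand_state_cong:
  assumes "cup_free w" "\<And>j. j < n \<Longrightarrow> l j = l' j"
  shows "strand_state (n, w) l = strand_state (n, w) l'"
proof
  fix r
  have "pure_tensor (strand (length w) ` {..<n}) (\<lambda>\<gamma>. l (strand_index \<gamma>)) =
      pure_tensor (strand (length w) ` {..<n}) (\<lambda>\<gamma>. l' (strand_index \<gamma>))"
    by (rule pure_tensor_cong) (use assms(2) in auto)
  then show "strand_state (n, w) l r = strand_state (n, w) l' r" 
    by (simp add: strand_state_apply[OF assms(1)])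
qed

lemma strand_state_alternating:
  assumes "cup_free w" "n \<ge> 1"
  shows "strand_state (n, w) (alternating c e) = scale c (strand_state (n, w) (parity_label e))"
proof -
  have "(\<Prod>j<n. if j = 0 then c else 1) = c" using assms(2) by (simp add: prod.delta)
  then show ?thesis
    using strand_state_scale[OF assms(1), of n "\<lambda>j. if j = 0 then c else 1" "parity_label e"]
    by (simp add: alternating_def[abs_def])
qed

lemma beta_strand_state:
  "(if e then beta_bar B else beta B) = strand_state (closure_diagram B) (parity_label e)"
proof -
  obtain n w where D: "closure_diagram B = (n, w)" "n \<ge> 1" "cup_free w" by (rule braid_diagram[of B])
  have "pure_tensor (strand (length w) ` {..<n})
        (\<lambda>\<gamma>. if e then (if even (nesting (n, w) \<gamma>) then x_bullet else x_circ)
             else (if even (nesting (n, w) \<gamma>) then x_circ else x_bullet)) =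
      pure_tensor (strand (length w) ` {..<n}) (\<lambda>\<gamma>. parity_label e (strand_index \<gamma>))"
    by (rule pure_tensor_cong) (auto simp: parity_label_def nesting_strand[OF D(3)])
  then show ?thesis
    by (cases e) (simp_all add: beta_def beta_bar_def Let_def D(1) strand_state_def pure_state_def
        circles_oriented[OF D(3)] cong: if_cong)
qed

lemma scale_beta:
  "scale c (if e then beta_bar B else beta B) = strand_state (closure_diagram B) (alternating c e)"
proof -
  obtain n w where D: "closure_diagram B = (n, w)" "n \<ge> 1" "cup_free w" by (rule braid_diagram[of B])
  show ?thesis unfolding beta_strand_state D(1) by (rule strand_state_alternating[OF D(3,2), symmetric])
qed

lemma snd_parity_label: "snd (parity_label e j) = 1"
  by (simp add: parity_label_def x_circ_def x_bullet_def A_X_def)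

lemma alternating_top_coefficient:
  assumes "cup_free w" "n \<ge> 1"
  shows "strand_state (n, w) (alternating c e) (oriented_res (n, w)) (strand (length w) ` {..<n}) = c"
  unfolding strand_state_alternating[OF assms] scale_def strand_state_apply[OF assms(1)]
  by (simp add: pure_tensor_def prod.reindex[OF inj_strand] snd_parity_label)

text \<open>
  The constant term of the label of the outermost strand, all others contributing the coefficient of \<open>X\<close>, which is
  \<open>1\<close>. It tells \<open>x_circ\<close> from \<open>x_bullet\<close>.
\<close>
lemma alternating_outer_coefficient:
  assumes "cup_free w" "n \<ge> 1"
  shows "strand_state (n, w) (alternating c e) (oriented_res (n, w)) (strand (length w) ` {..<n} - {strand (length w) 0}) =
    - c * (if e then x2 else x1)"
proof -
  let ?P = "strand (length w) ` {..<n}" and ?o = "strand (length w) 0"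
  have mem: "?o \<in> ?P" using assms(2) by auto
  have one: "(\<Prod>\<gamma>\<in>?P - {?o}. if \<gamma> \<in> ?P - {?o} then snd (parity_label e (strand_index \<gamma>))
      else fst (parity_label e (strand_index \<gamma>))) = 1"
    by (rule prod.neutral) (simp add: snd_parity_label)
  have "pure_tensor ?P (\<lambda>\<gamma>. parity_label e (strand_index \<gamma>)) (?P - {?o}) = fst (parity_label e 0)"
    unfolding pure_tensor_def using one by (subst prod.remove[OF _ mem]) auto
  then show ?thesis
    unfolding strand_state_alternating[OF assms] scale_def strand_state_apply[OF assms(1)]
    by (simp add: parity_label_def x_circ_def x_bullet_def A_X_def)
qed

lemma alternating_eqD:
  assumes "strand_state (closure_diagram B) (alternating c e) = strand_state (closure_diagram B) (alternating c' e')"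
  shows "c = c'" and "c \<noteq> 0 \<Longrightarrow> x1 \<noteq> x2 \<Longrightarrow> e = e'"
proof -
  obtain n w where D: "closure_diagram B = (n, w)" "n \<ge> 1" "cup_free w" by (rule braid_diagram[of B])
  show c: "c = c'"
    using alternating_top_coefficient[OF D(3,2), of c e] alternating_top_coefficient[OF D(3,2), of c' e']
      assms D(1) by simp
  show "e = e'" if "c \<noteq> 0" "x1 \<noteq> x2"
  proof -
    have "- c * (if e then x2 else x1) = - c * (if e' then x2 else x1)"
      using alternating_outer_coefficient[OF D(3,2), of c e] alternating_outer_coefficient[OF D(3,2), of c e']
        assms[unfolded D(1), folded c] by (simp only:)
    then have "(if e then x2 else x1) = (if e' then x2 else x1)" using that(1) by (simp only: mult_cancel_left neg_equal_0_iff_equal simp_thms)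
    then show ?thesis using that(2) by (cases e; cases e'; simp)
  qed
qed

lemma alternating_eq_0_iff:
  "strand_state (closure_diagram B) (alternating c e) = (\<lambda>_ _. 0) \<longleftrightarrow> c = 0"
proof -
  obtain n w where D: "closure_diagram B = (n, w)" "n \<ge> 1" "cup_free w" by (rule braid_diagram[of B])
  show ?thesis
  proof
    assume "strand_state (closure_diagram B) (alternating c e) = (\<lambda>_ _. 0)"
    then show "c = 0" using alternating_top_coefficient[OF D(3,2), of c e] D(1) by simp
  next
    assume "c = 0"
    then show "strand_state (closure_diagram B) (alternating c e) = (\<lambda>_ _. 0)"
      using strand_state_alternating[OF D(3,2), of c e] D(1) by (simp add: scale_def)
  qed
qed

section \<open>Plamenevskaya-type invariants are multiples of beta-cycles\<close>

text \<open>
  If \<open>(X - x1) * b\<close> is divisible by \<open>(X - x1) * (X - x2)\<close>, then \<open>b\<close> is a multiple of \<open>X - x2\<close>. The scalar \<open>c\<close>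
  can be cancelled because the scalars form a domain.
\<close>
lemma annihilator_x_circ:
  assumes "A_mult (A_scale c x_circ) b = 0" "c \<noteq> 0"
  shows "b = A_scale (snd b) x_bullet"
proof -
  have "c * (fst b + x2 * snd b) = 0"
    using assms(1) by (simp add: A_mult_def A_scale_def x_circ_def A_X_def zero_prod_def algebra_simps)
  then have "fst b = - x2 * snd b" using assms(2) by (simp add: add_eq_0_iff2)
  then show ?thesis by (simp add: prod_eq_iff A_scale_def x_bullet_def A_X_def mult.commute)
qed

lemma annihilator_x_bullet:
  assumes "A_mult (A_scale c x_bullet) b = 0" "c \<noteq> 0"
  shows "b = A_scale (snd b) x_circ"
proof -
  have "c * (fst b + x1 * snd b) = 0"
    using assms(1) by (simp add: A_mult_def A_scale_def x_bullet_def A_X_def zero_prod_def algebra_simps)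
  then have "fst b = - x1 * snd b" using assms(2) by (simp add: add_eq_0_iff2)
  then show ?thesis by (simp add: prod_eq_iff A_scale_def x_circ_def A_X_def mult.commute)
qed

text \<open>
  As polynomials of degree at most one, \<open>a\<close> and \<open>b\<close> have a product which is a scalar multiple of
  \<open>(X - x1) * (X - x2)\<close>, so \<open>x1\<close> or \<open>x2\<close> is a root of \<open>a\<close>. The identity in the proof expresses the product
  of the values of \<open>a\<close> at \<open>x1\<close> and \<open>x2\<close>, times the leading coefficient of \<open>b\<close>, through the coefficients of
  \<open>a * b\<close>.
\<close>
lemma zero_divisor_cases:
  assumes "A_mult a b = 0" "a \<noteq> 0" "b \<noteq> 0"
  shows "a = A_scale (snd a) x_circ \<or> a = A_scale (snd a) x_bullet"
proof -
  obtain a0 a1 b0 b1 where ab: "a = (a0, a1)" "b = (b0, b1)" by fastforce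
  have eq0: "a0 * b0 = x1 * x2 * (a1 * b1)" and eq1: "a0 * b1 + a1 * b0 + (x1 + x2) * (a1 * b1) = 0"
    using assms(1) by (simp_all add: ab A_mult_def zero_prod_def)
  \<comment> \<open>A nonzero constant is not a zero divisor.\<close>
  have b1: "b1 \<noteq> 0" using eq0 eq1 assms(2,3) by (auto simp: ab zero_prod_def)
  have "(a0 + x1 * a1) * (a0 + x2 * a1) * b1 =
      a0 * (a0 * b1 + (x1 + x2) * (a1 * b1)) + a1 * (x1 * x2 * (a1 * b1))"
    by (simp add: algebra_simps)
  also have "\<dots> = a0 * (a0 * b1 + a1 * b0 + (x1 + x2) * (a1 * b1))"
    unfolding eq0[symmetric] by (simp add: algebra_simps)
  finally have "a0 + x1 * a1 = 0 \<or> a0 + x2 * a1 = 0" using b1 eq1 by simp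
  then show ?thesis
    by (auto simp: ab A_scale_def x_circ_def x_bullet_def A_X_def add_eq_0_iff2 mult.commute)
qed

text \<open>
  The first two labels decide which of the two alternating patterns occurs; then each label determines the
  type of the next one. If \<open>x1 = x2\<close>, both patterns agree.
\<close>
lemma zero_divisor_chain:
  assumes zero: "\<And>j. Suc j < n \<Longrightarrow> A_mult (l j) (l (Suc j)) = 0"
    and nz: "\<And>j. j < n \<Longrightarrow> l j \<noteq> 0" and n: "n \<ge> 2"
  shows "\<exists>e. \<forall>j<n. l j = A_scale (snd (l j)) (parity_label e j)"
proof -
  have "l 0 = A_scale (snd (l 0)) x_circ \<or> l 0 = A_scale (snd (l 0)) x_bullet"
    using zero_divisor_cases[of "l 0" "l 1"] zero[of 0] nz[of 0] nz[of 1] n by simp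
  then obtain e where e: "l 0 = A_scale (snd (l 0)) (parity_label e 0)"
    unfolding parity_label_def by (metis even_zero)
  have "l j = A_scale (snd (l j)) (parity_label e j)" if "j < n" for j
    using that
  proof (induction j)
    case 0
    then show ?case using e by simp
  next
    case (Suc j)
    then have IH: "l j = A_scale (snd (l j)) (parity_label e j)" by simp
    have c: "snd (l j) \<noteq> 0"
    proof
      assume "snd (l j) = 0"
      then have "l j = 0" using IH by (simp add: A_scale_def zero_prod_def)
      then show False using nz[of j] Suc by simp
    qed
    have z: "A_mult (A_scale (snd (l j)) (parity_label e j)) (l (Suc j)) = 0"
      using zero[OF Suc.prems] IH by simp
    show ?case
    proof (cases "even j = e")
      case True
      then show ?thesis using annihilator_x_bullet[of "snd (l j)" "l (Suc j)"] z c
        by (simp add: parity_label_def)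
    next
      case False
      then show ?thesis using annihilator_x_circ[of "snd (l j)" "l (Suc j)"] z c
        by (simp add: parity_label_def)
    qed
  qed
  then show ?thesis by blast
qed

lemma enhanced_state_strand_state:
  assumes "cup_free w" "enhanced_state (n, w) (oriented_res (n, w)) z"
  shows "\<exists>l. z = strand_state (n, w) l"
proof -
  obtain \<alpha> where \<alpha>: "z = pure_state (n, w) (oriented_res (n, w)) \<alpha>"
    using assms(2) by (auto simp: enhanced_state_def)
  have "pure_tensor (circles (n, w) (oriented_res (n, w))) \<alpha> =
      pure_tensor (circles (n, w) (oriented_res (n, w))) (\<lambda>\<gamma>. \<alpha> (strand (length w) (strand_index \<gamma>)))"
    unfolding circles_oriented[OF assms(1)] by (rule pure_tensor_cong) auto
  then have "z = strand_state (n, w) (\<lambda>j. \<alpha> (strand (length w) j))"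
    by (simp add: \<alpha> strand_state_def pure_state_def cong: if_cong)
  then show ?thesis by blast
qed

lemma plamenevskaya_type_move:
  assumes "plamenevskaya_type H x" "braid_move \<mu> B B'"
  shows "move_map H \<mu> (closure_diagram B) (closure_diagram B') (x B) = x B'"
proof -
  have "sequence_map H ([] @ [\<mu>]) B B' (move_map H \<mu> (closure_diagram B) (closure_diagram B') \<circ> id)"
    by (rule sequence_map.snoc[OF sequence_map.nil assms(2)])
  then show ?thesis using assms(1) unfolding plamenevskaya_type_def by fastforce
qed

lemma plamenevskaya_type_strand_state:
  assumes "plamenevskaya_type H x" "closure_diagram B = (n, w)" "cup_free w"
  shows "\<exists>l. x B = strand_state (n, w) l"
proof -
  have "enhanced_state (closure_diagram B) (oriented_res (closure_diagram B)) (x B)"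
    using assms(1) unfolding plamenevskaya_type_def by blast
  then show ?thesis using enhanced_state_strand_state[OF assms(3)] by (simp add: assms(2))
qed

lemma plamenevskaya_type_labels_nonzero:
  assumes "plamenevskaya_type H x" "x B = strand_state (n, w) l" "cup_free w" "j < n"
  shows "l j \<noteq> 0"
proof
  assume "l j = 0"
  then have "pure_tensor (strand (length w) ` {..<n}) (\<lambda>\<gamma>. l (strand_index \<gamma>)) = (\<lambda>_. 0)"
    using assms(4) by (subst pure_tensor_eq_0_iff) auto
  then have "x B = (\<lambda>_ _. 0)" by (simp add: assms(2) strand_state_apply[OF assms(3)] fun_eq_iff)
  then show False using assms(1) unfolding plamenevskaya_type_def by blast
qed

text \<open>
  Create two crossings between the strands \<open>i\<close> and \<open>i + 1\<close> at the bottom of the braid. The invariant of the new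
  braid vanishes on the resolution with the two cups, where the image under the move is the pure tensor
  with label \<open>l i * l (i + 1)\<close> on the merged circle and nonzero labels elsewhere.
\<close>
lemma adjacent_labels:
  assumes x: "plamenevskaya_type H x" and D: "closure_diagram B = (n, w)" and l: "x B = strand_state (n, w) l"
    and i: "Suc i < n"
  shows "A_mult (l i) (l (Suc i)) = 0"
proof -
  obtain n' w0 where D0: "closure_diagram B = (n', w0)" "n' \<ge> 1" "cup_free w0"
    "\<forall>a \<in> set w0. \<exists>i. Suc i < n' \<and> (a = Pos i \<or> a = Neg i)" by (rule braid_diagram[of B])
  have [simp]: "n' = n" "w0 = w" using D D0 by auto
  let ?w' = "[Pos i, Neg i] @ w" and ?ws = "[Straight, Straight] @ w"
  define B' where "B' = Abs_braid (n, ?w')"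
  have D': "closure_diagram B' = (n, ?w')"
    unfolding B'_def closure_diagram_def by (rule Abs_braid_inverse) (use D0 i in auto)
  have "braid_move (R2_Create 0) B B'"
    unfolding braid_move_def D D' using applies.create[of "Pos i" "Neg i" i "[]" n w] by simp
  from plamenevskaya_type_move[OF x this]
  have xB': "Psi2 (n, ?w') 0 1 (insert_straight (n, w) (n, ?ws) 0 (strand_state (n, w) l)) = x B'"
    by (simp add: D D' l)
  have cf: "cup_free ?w'" "cup_free ([] @ w)" using D0(3) by auto
  have straight: "insert_straight (n, w) (n, ?ws) 0 (strand_state (n, w) l) = strand_state (n, ?ws) l"
    using insert_straight_strand_state[OF cf(2), of n l] by simp
  have site: "second_move_site n ?w' 0 1 i"
    using second_move_site_pair[of "[]" "Pos i" "Neg i" w i n] cf i by simp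
  have c: "r2_crossings (n, ?w') 0 1 = (1, 0)" by (simp add: r2_crossings.simps)
  let ?s = "insert 0 (oriented_res (n, ?ws))"
  have "0 \<notin> oriented_res (n, ?w')" by (simp add: oriented_res_iff)
  then have ne: "?s \<noteq> oriented_res (n, ?w')" by blast
  have "\<exists>l'. x B' = strand_state (n, ?w') l'"
    by (rule plamenevskaya_type_strand_state[OF x D' cf(1)])
  then obtain l' where l': "x B' = strand_state (n, ?w') l'" by blast
  have "x B' ?s = (\<lambda>_. 0)"
    unfolding l' strand_state_apply[OF cf(1)] by (rule if_not_P[OF ne])
  then have "Psi2 (n, ?w') 0 1 (strand_state (n, ?ws) l) ?s = (\<lambda>_. 0)"
    using xB' straight by simp
  then have cases: "A_mult (l i) (l (Suc i)) = 0 \<or> (\<exists>j<n. j \<noteq> i \<and> j \<noteq> Suc i \<and> l j = 0)"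
    using Psi2_cup_component_eq_0_iff[OF site c, of l] by simp
  have "\<forall>j<n. l j \<noteq> 0"
    using plamenevskaya_type_labels_nonzero[OF x l] D0(3) by simp
  then show ?thesis using cases by blast
qed

text \<open>
  With at least two strands, adjacent labels have product zero. A braid on one strand is
  stabilized, and the form of the invariant on two strands is transported back by the destabilization.
\<close>
lemma plamenevskaya_type_alternating:
  assumes x: "plamenevskaya_type H x" and H: "homotopy_choice H"
  shows "\<exists>r e. x B = strand_state (closure_diagram B) (alternating r e)"
proof -
  have large: "\<exists>r e. x B = strand_state (closure_diagram B) (alternating r e)"
    if D: "closure_diagram B = (n, w)" "n \<ge> 2" for B n w
  proof -
    obtain n' w' where D0: "closure_diagram B = (n', w')" "n' \<ge> 1" "cup_free w'" by (rule braid_diagram[of B])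
    then have w: "cup_free w" using D by simp
    obtain l where l: "x B = strand_state (n, w) l"
      using plamenevskaya_type_strand_state[OF x D(1) w] by blast
    have zero: "A_mult (l j) (l (Suc j)) = 0" if "Suc j < n" for j
      by (rule adjacent_labels[OF x D(1) l that])
    have nz: "\<forall>j<n. l j \<noteq> 0"
      using plamenevskaya_type_labels_nonzero[OF x l w] by blast
    obtain e where e: "\<forall>j<n. l j = A_scale (snd (l j)) (parity_label e j)"
      using zero_divisor_chain[where l = l and n = n, OF zero _ D(2)] nz by blast
    have "strand_state (n, w) l = strand_state (n, w) (\<lambda>j. A_scale (snd (l j)) (parity_label e j))"
      by (rule strand_state_cong[OF w]) (use e in blast)
    also have "\<dots> = scale (\<Prod>j<n. snd (l j)) (strand_state (n, w) (parity_label e))"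
      by (rule strand_state_scale[OF w])
    also have "\<dots> = strand_state (n, w) (alternating (\<Prod>j<n. snd (l j)) e)"
      using strand_state_alternating[OF w] D(2) by simp
    finally show ?thesis using l D(1) by auto
  qed
  obtain n w where D: "closure_diagram B = (n, w)" "n \<ge> 1" "cup_free w"
    "\<forall>a \<in> set w. \<exists>i. Suc i < n \<and> (a = Pos i \<or> a = Neg i)" by (rule braid_diagram[of B])
  show ?thesis
  proof (cases "n \<ge> 2")
    case False
    then have n: "n = 1" using D(2) by simp
    define B' where "B' = Abs_braid (Suc n, w @ [Pos (n - 1)])"
    have D': "closure_diagram B' = (Suc n, w @ [Pos (n - 1)])"
      unfolding B'_def closure_diagram_def
      by (rule Abs_braid_inverse) (use D(2,4) n in auto)
    have move: "braid_move Destabilize B' B"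
      unfolding braid_move_def D(1) D' by (rule applies.destabilize)
    obtain r e where "x B' = strand_state (closure_diagram B') (alternating r e)"
      using large[OF D'] n by auto
    then have "x B = strand_state (closure_diagram B) (alternating r e)"
      using plamenevskaya_type_move[OF x move] move_map_alternating[OF move H, of r e] by simp
    then show ?thesis by blast
  qed (use large[OF D(1)] in blast)
qed

lemma alternating_plamenevskaya_type:
  assumes H: "homotopy_choice H" and \<rho>: "transverse_invariant \<rho>" "\<forall>B. \<rho> B \<noteq> 0"
    and \<epsilon>: "transverse_invariant \<epsilon>"
  shows "plamenevskaya_type H (\<lambda>B. strand_state (closure_diagram B) (alternating (\<rho> B) (\<epsilon> B)))"
    (is "plamenevskaya_type H ?x")
proof -
  have step: "move_map H \<mu> (closure_diagram B) (closure_diagram B') (?x B) = ?x B'" if "braid_move \<mu> B B'" for \<mu> B B'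
  proof -
    have "\<rho> B = \<rho> B'" "\<epsilon> B = \<epsilon> B'" using \<rho>(1) \<epsilon> that unfolding transverse_invariant_def by blast+
    then show ?thesis using move_map_alternating[OF that H] by simp
  qed
  have "\<Phi> (?x B) = ?x B'" if "sequence_map H \<Sigma> B B' \<Phi>" for \<Sigma> B B' \<Phi>
    using that by (induction rule: sequence_map.induct) (simp_all add: step)
  moreover have "enhanced_state (closure_diagram B) (oriented_res (closure_diagram B)) (?x B)" for B
    unfolding enhanced_state_def strand_state_def by blast
  ultimately show ?thesis
    unfolding plamenevskaya_type_def using \<rho>(2) by (simp add: alternating_eq_0_iff)
qed

text \<open>
  A move sends the multiple of a \<open>\<beta>\<close>-cycle at one braid to the same multiple of the same \<open>\<beta>\<close>-cycle at the
  other; since both are determined by the chain, they are invariants. For \<open>x1 = x2\<close> the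
  two \<open>\<beta>\<close>-cycles coincide and the choice between them is arbitrary at each braid.
\<close>
lemma plamenevskaya_type_coefficients:
  assumes x: "plamenevskaya_type H x" and H: "homotopy_choice H"
  obtains \<rho> \<epsilon> where "transverse_invariant \<rho>" "\<forall>B. \<rho> B \<noteq> 0" "x1 \<noteq> x2 \<longrightarrow> transverse_invariant \<epsilon>"
    "x = (\<lambda>B. strand_state (closure_diagram B) (alternating (\<rho> B) (\<epsilon> B)))"
proof -
  obtain \<rho> \<epsilon> where form: "\<And>B. x B = strand_state (closure_diagram B) (alternating (\<rho> B) (\<epsilon> B))"
    using plamenevskaya_type_alternating[OF x H] by metis
  have nz: "\<rho> B \<noteq> 0" for B
    using x form alternating_eq_0_iff unfolding plamenevskaya_type_def by metis
  have same: "strand_state (closure_diagram B') (alternating (\<rho> B) (\<epsilon> B)) =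
      strand_state (closure_diagram B') (alternating (\<rho> B') (\<epsilon> B'))" if "braid_move \<mu> B B'" for \<mu> B B'
    using plamenevskaya_type_move[OF x that] move_map_alternating[OF that H, of "\<rho> B" "\<epsilon> B"]
    by (simp add: form)
  show ?thesis
  proof (rule that)
    show "transverse_invariant \<rho>"
      unfolding transverse_invariant_def using alternating_eqD(1)[OF same] by blast
    show "x1 \<noteq> x2 \<longrightarrow> transverse_invariant \<epsilon>"
      unfolding transverse_invariant_def using alternating_eqD(2)[OF same nz] by blast
    show "x = (\<lambda>B. strand_state (closure_diagram B) (alternating (\<rho> B) (\<epsilon> B)))" using form by blast
  qed (use nz in blast)
qed

end

section \<open>Counting transverse invariants\<close>
instance letter :: countable by countable_datatype

lemma countable_braids: "countable (UNIV :: braid set)"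
proof -
  have "inj Rep_braid" by (rule injI) (simp add: Rep_braid_inject)
  then show ?thesis
    by (rule countable_image_inj_on[rotated]) (rule countable_subset[OF subset_UNIV countableI_type])
qed

fun crossing_sign :: "letter \<Rightarrow> int" where
  "crossing_sign (Pos i) = 1"
| "crossing_sign (Neg i) = - 1"
| "crossing_sign (Cup i) = 0"
| "crossing_sign Straight = 0"

text \<open>
  The writhe minus the number of strands. A stabilization raises both by one, and second moves, third moves and
  isotopies change neither.
\<close>
definition self_linking :: "braid \<Rightarrow> int" where
  "self_linking B = (case closure_diagram B of (n, w) \<Rightarrow> sum_list (map crossing_sign w) - int n)"

lemma self_linking_invariant: "transverse_invariant self_linking"
proof -
  have "(case D of (n, w) \<Rightarrow> sum_list (map crossing_sign w) - int n) =
      (case D' of (n, w) \<Rightarrow> sum_list (map crossing_sign w) - int n)" if "applies \<mu> D D'" for \<mu> D D'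
    using that by cases (auto simp: doubleton_eq_iff)
  then show ?thesis
    unfolding transverse_invariant_def self_linking_def braid_move_def by blast
qed

lemma infinite_range_self_linking: "infinite (range self_linking)"
proof -
  have "int m - 2 \<in> range self_linking" for m
  proof -
    have "closure_diagram (Abs_braid (2, replicate m (Pos 0))) = (2, replicate m (Pos 0))"
      unfolding closure_diagram_def by (rule Abs_braid_inverse) auto
    then have "self_linking (Abs_braid (2, replicate m (Pos 0))) = int m - 2"
      by (simp add: self_linking_def sum_list_replicate)
    then show ?thesis by (metis rangeI)
  qed
  then have "range (\<lambda>m. int m - 2) \<subseteq> range self_linking" by blast
  moreover have "infinite (range (\<lambda>m. int m - 2))"
    by (rule range_inj_infinite) (simp add: inj_def)
  ultimately show ?thesis by (rule infinite_super)
qed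

text \<open>
  The equivalence relation generated by the moves. The invariants with truth values are the unions of its
  classes, so no chains of moves are needed to define it.
\<close>
definition transversely_equivalent :: "braid \<Rightarrow> braid \<Rightarrow> bool" where
  "transversely_equivalent B B' \<longleftrightarrow> (\<forall>f :: braid \<Rightarrow> bool. transverse_invariant f \<longrightarrow> f B = f B')"

text \<open>
  If an invariant separates two braids, then so does the invariant with truth values which tests for
  its value at the first one.
\<close>
lemma transverse_invariant_iff:
  "transverse_invariant f \<longleftrightarrow> (\<forall>B B'. transversely_equivalent B B' \<longrightarrow> f B = f B')"
proof
  assume f: "transverse_invariant f"
  show "\<forall>B B'. transversely_equivalent B B' \<longrightarrow> f B = f B'"
  proof (intro allI impI)
    fix B B' assume "transversely_equivalent B B'"
    moreover have "transverse_invariant (\<lambda>C. f C = f B)"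
      using f unfolding transverse_invariant_def by metis
    ultimately have "(f B = f B) = (f B' = f B)" unfolding transversely_equivalent_def by blast
    then show "f B = f B'" by simp
  qed
next
  assume "\<forall>B B'. transversely_equivalent B B' \<longrightarrow> f B = f B'"
  moreover have "transversely_equivalent B B'" if "braid_move \<mu> B B'" for \<mu> B B'
    using that unfolding transversely_equivalent_def transverse_invariant_def by blast
  ultimately show "transverse_invariant f" unfolding transverse_invariant_def by blast
qed

text \<open>
  There are infinitely many classes because the self-linking number takes infinitely many values, and at most
  countably many because words over a countable alphabet are countable.
\<close>
lemma class_enumeration:
  obtains c :: "braid \<Rightarrow> nat" where "surj c" "\<And>B B'. c B = c B' \<longleftrightarrow> transversely_equivalent B B'"
proof -
  define cls where "cls B = {B'. transversely_equivalent B B'}" for B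
  have cls: "cls B = cls B' \<longleftrightarrow> transversely_equivalent B B'" for B B'
    unfolding cls_def transversely_equivalent_def by blast
  have self: "B \<in> cls B" for B by (simp add: cls_def transversely_equivalent_def)
  have sl: "self_linking B = self_linking (SOME B'. B' \<in> cls B)" for B
    using someI[of "\<lambda>B'. B' \<in> cls B", OF self] self_linking_invariant
    unfolding transverse_invariant_iff by (simp add: cls_def)
  have "range self_linking \<subseteq> (\<lambda>S. self_linking (SOME B'. B' \<in> S)) ` range cls"
    using sl by blast
  then have inf: "infinite (range cls)"
    using infinite_range_self_linking finite_surj by blast
  have count: "countable (range cls)" using countable_braids by blast
  have bij: "bij_betw (to_nat_on (range cls)) (range cls) UNIV"
    by (rule to_nat_on_infinite[OF count inf])
  show ?thesis
  proof (rule that[of "to_nat_on (range cls) \<circ> cls"])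
    show "surj (to_nat_on (range cls) \<circ> cls)"
      unfolding image_comp[symmetric] using bij by (simp add: bij_betw_def)
    show "(to_nat_on (range cls) \<circ> cls) B = (to_nat_on (range cls) \<circ> cls) B' \<longleftrightarrow>
        transversely_equivalent B B'" for B B'
      by (simp add: to_nat_on_inj[OF count rangeI rangeI] cls)
  qed
qed

definition invariants_into :: "'a set \<Rightarrow> (braid \<Rightarrow> 'a) set" where
  "invariants_into S = {f. transverse_invariant f \<and> range f \<subseteq> S}"

lemma invariants_into_UNIV: "{f. transverse_invariant f} = invariants_into UNIV"
  by (simp add: invariants_into_def)

lemma nonvanishing_invariants:
  "{\<rho>. transverse_invariant \<rho> \<and> (\<forall>B. \<rho> B \<noteq> 0)} = invariants_into (UNIV - {0 :: 'r::idom})"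
  by (auto simp: invariants_into_def)

lemma invariants_into_eqpoll_pointwise:
  assumes "S \<approx> T"
  shows "invariants_into S \<approx> invariants_into T"
proof -
  have le: "invariants_into S \<lesssim> invariants_into T" if ST: "S \<lesssim> T" for S :: "'x set" and T :: "'y set"
  proof -
    obtain g where g: "inj_on g S" "g ` S \<subseteq> T" using ST unfolding lepoll_def by blast
    have "inj_on ((\<circ>) g) (invariants_into S)"
    proof (rule inj_onI)
      fix f f' assume f: "f \<in> invariants_into S" "f' \<in> invariants_into S" "g \<circ> f = g \<circ> f'"
      show "f = f'"
      proof
        fix B
        have "f B \<in> S" "f' B \<in> S" "g (f B) = g (f' B)"
          using f by (auto simp: invariants_into_def dest: fun_cong)
        then show "f B = f' B" using g(1) by (simp add: inj_on_def)
      qed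
    qed
    moreover have "(\<circ>) g ` invariants_into S \<subseteq> invariants_into T"
      using g(2) by (fastforce simp: invariants_into_def transverse_invariant_def)
    ultimately show ?thesis unfolding lepoll_def by blast
  qed
  show ?thesis
    using assms by (intro lepoll_antisym le) (auto simp: eqpoll_imp_lepoll eqpoll_sym)
qed

text \<open>
  An invariant is a function on the classes, that is, on the natural numbers. It is coded by its
  graph, a subset of \<open>nat \<times> nat\<close>; through the pairing function this is a function on \<open>nat\<close> with two
  values, here \<open>a\<close> and \<open>b\<close>, and hence again an invariant.
\<close>
lemma invariants_into_lepoll:
  assumes S: "countable S" and ab: "a \<in> T" "b \<in> T" "a \<noteq> b"
  shows "invariants_into S \<lesssim> invariants_into T"
proof -
  obtain c :: "braid \<Rightarrow> nat" where c: "surj c" "\<And>B B'. c B = c B' \<longleftrightarrow> transversely_equivalent B B'"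
    using class_enumeration by blast
  define d where "d = inv_into UNIV c"
  have d: "c (d m) = m" for m unfolding d_def by (rule surj_f_inv_f[OF c(1)])
  let ?code = "to_nat_on S"
  define F where "F f = (\<lambda>B. case prod_decode (c B) of (m, k) \<Rightarrow> if ?code (f (d m)) = k then a else b)"
    for f :: "braid \<Rightarrow> 'a"
  have "inj_on F (invariants_into S)"
  proof (rule inj_onI)
    fix f f' assume f: "f \<in> invariants_into S" "f' \<in> invariants_into S" and eq: "F f = F f'"
    have sec: "f (d m) = f' (d m)" for m
    proof -
      let ?k = "?code (f (d m))"
      have "F f (d (prod_encode (m, ?k))) = a" by (simp add: F_def d)
      then have "F f' (d (prod_encode (m, ?k))) = a" using eq by simp
      then have "?code (f' (d m)) = ?k" using ab(3) by (simp add: F_def d split: if_splits)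
      moreover have "f (d m) \<in> S" "f' (d m) \<in> S" using f by (auto simp: invariants_into_def)
      ultimately show ?thesis using S by simp
    qed
    show "f = f'"
    proof
      fix B
      have "transversely_equivalent B (d (c B))" using c(2) d by metis
      then have "f B = f (d (c B))" "f' B = f' (d (c B))"
        using f unfolding invariants_into_def transverse_invariant_iff by blast+
      then show "f B = f' B" using sec by simp
    qed
  qed
  moreover have "F ` invariants_into S \<subseteq> invariants_into T"
  proof
    fix g assume "g \<in> F ` invariants_into S"
    then obtain f where g: "g = F f" by blast
    have "transverse_invariant g"
      unfolding transverse_invariant_iff g F_def by (metis c(2))
    moreover have "range g \<subseteq> T" using ab by (auto simp: g F_def split: prod.splits)
    ultimately show "g \<in> invariants_into T" by (simp add: invariants_into_def)
  qed
  ultimately show ?thesis unfolding lepoll_def by blast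
qed

lemma invariants_into_eqpoll_finite:
  assumes "finite S" "finite T" "card S \<ge> 2" "card T \<ge> 2"
  shows "invariants_into S \<approx> invariants_into T"
proof -
  have two: "\<exists>a\<in>S. \<exists>b\<in>S. a \<noteq> b" if "card S \<ge> 2" for S :: "'x set"
    using that by (metis card_2_iff' card_le_Suc0_iff_eq card.infinite not_less_eq_eq numeral_2_eq_2 zero_le)
  obtain a b a' b' where "a \<in> S" "b \<in> S" "a \<noteq> b" "a' \<in> T" "b' \<in> T" "a' \<noteq> b'"
    using two[OF assms(3)] two[OF assms(4)] by blast
  then show ?thesis
    using assms(1,2) by (intro lepoll_antisym invariants_into_lepoll) (auto intro: countable_finite)
qed

lemma infinite_minus_eqpoll: "infinite S \<Longrightarrow> S - {a} \<approx> S"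
  using infinite_insert_eqpoll[of "S - {a}" a]
  by (cases "a \<in> S") (auto simp: insert_absorb intro: eqpoll_sym)

lemma infinite_times_bool_eqpoll:
  assumes "infinite S"
  shows "(S - {a}) \<times> (UNIV :: bool set) \<approx> S"
proof (rule lepoll_antisym)
  have "(S - {a}) \<times> (UNIV :: bool set) \<lesssim> S \<times> S"
  proof (rule times_lepoll_mono)
    show "S - {a} \<lesssim> S" by (rule subset_imp_lepoll) blast
    show "(UNIV :: bool set) \<lesssim> S" by (rule finite_lepoll_infinite[OF assms]) simp
  qed
  moreover have "S \<times> S \<approx> S"
    using card_of_Times_same_infinite[OF assms] card_of_ordIso unfolding eqpoll_def by blast
  ultimately show "(S - {a}) \<times> (UNIV :: bool set) \<lesssim> S" by (meson eqpoll_imp_lepoll lepoll_trans)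
  have "S \<lesssim> S - {a}" using infinite_minus_eqpoll[OF assms] eqpoll_imp_lepoll eqpoll_sym by blast
  moreover have "S - {a} \<lesssim> (S - {a}) \<times> (UNIV :: bool set)"
    unfolding lepoll_def by (rule exI[of _ "\<lambda>s. (s, True)"]) (auto simp: inj_on_def)
  ultimately show "S \<lesssim> (S - {a}) \<times> (UNIV :: bool set)" by (rule lepoll_trans)
qed

lemma invariants_into_times:
  "invariants_into S \<times> invariants_into T \<approx> invariants_into (S \<times> T)"
  unfolding eqpoll_def
proof (rule exI)
  show "bij_betw (\<lambda>(f, g) B. (f B, g B)) (invariants_into S \<times> invariants_into T) (invariants_into (S \<times> T))"
    by (rule bij_betw_byWitness[of _ "\<lambda>h. (fst \<circ> h, snd \<circ> h)"])
      (auto simp: invariants_into_def transverse_invariant_def image_subset_iff mem_Times_iff)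
qed

text \<open>
  For the field with two elements there is just one nonvanishing invariant, so this case is
  excluded.
\<close>
lemma nonvanishing_invariants_eqpoll:
  assumes "card (UNIV :: 'r::idom set) \<noteq> 2"
  shows "invariants_into (UNIV - {0 :: 'r}) \<approx> invariants_into (UNIV :: 'r set)"
proof (cases "finite (UNIV :: 'r set)")
  case True
  have "card {0 :: 'r, 1} \<le> card (UNIV :: 'r set)" by (rule card_mono[OF True]) simp
  then have "card (UNIV :: 'r set) \<ge> 3" using assms by simp
  moreover from this have "card (UNIV - {0 :: 'r}) \<ge> 2" using True by (simp add: card_Diff_singleton)
  ultimately show ?thesis using True by (intro invariants_into_eqpoll_finite) auto
next
  case False
  then show ?thesis by (intro invariants_into_eqpoll_pointwise infinite_minus_eqpoll)
qed

text \<open>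
  Here the field with two elements is allowed, because the truth value already takes two values.
\<close>
lemma signed_nonvanishing_invariants_eqpoll:
  "invariants_into (UNIV - {0 :: 'r::idom}) \<times> invariants_into (UNIV :: bool set) \<approx>
    invariants_into (UNIV :: 'r set)"
proof -
  let ?S = "(UNIV - {0 :: 'r}) \<times> (UNIV :: bool set)"
  have "invariants_into ?S \<approx> invariants_into (UNIV :: 'r set)"
  proof (cases "finite (UNIV :: 'r set)")
    case True
    have "card {0 :: 'r, 1} \<le> card (UNIV :: 'r set)" by (rule card_mono[OF True]) simp
    then have two: "card (UNIV :: 'r set) \<ge> 2" by simp
    then have "card ?S \<ge> 2" using True by (simp add: card_cartesian_product card_Diff_singleton)
    then show ?thesis using True two by (intro invariants_into_eqpoll_finite) auto
  next
    case False
    then show ?thesis by (intro invariants_into_eqpoll_pointwise infinite_times_bool_eqpoll)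
  qed
  then show ?thesis using invariants_into_times eqpoll_trans by blast
qed

section \<open>The classification\<close>

context frobenius_algebra
begin

lemma bij_betw_coefficients:
  assumes H: "homotopy_choice H" and eq: "x1 = x2"
  shows "bij_betw (\<lambda>\<rho> B. scale (\<rho> B) (beta B)) {\<rho>. transverse_invariant \<rho> \<and> (\<forall>B. \<rho> B \<noteq> 0)}
    {x. plamenevskaya_type H x}"
proof -
  have scale: "scale c (beta B) = strand_state (closure_diagram B) (alternating c e)" for c B e
  proof -
    have "x_circ = x_bullet" unfolding x_circ_def x_bullet_def using eq by simp
    then have "alternating c e = alternating c False" by (simp add: alternating_def parity_label_def fun_eq_iff)
    then show ?thesis using scale_beta[of c False B] by simp
  qed
  show ?thesis
  proof (rule bij_betwI')
    fix \<rho> \<rho>' :: "braid \<Rightarrow> 'r"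
    show "(\<lambda>B. scale (\<rho> B) (beta B)) = (\<lambda>B. scale (\<rho>' B) (beta B)) \<longleftrightarrow> \<rho> = \<rho>'"
    proof
      assume eq: "(\<lambda>B. scale (\<rho> B) (beta B)) = (\<lambda>B. scale (\<rho>' B) (beta B))"
      have "\<rho> B = \<rho>' B" for B
        by (rule alternating_eqD(1)[of B _ False _ False])
          (use fun_cong[OF eq, of B] in \<open>simp only: scale[of _ _ False]\<close>)
      then show "\<rho> = \<rho>'" by blast
    qed simp
  next
    fix \<rho> :: "braid \<Rightarrow> 'r" assume "\<rho> \<in> {\<rho>. transverse_invariant \<rho> \<and> (\<forall>B. \<rho> B \<noteq> 0)}"
    then show "(\<lambda>B. scale (\<rho> B) (beta B)) \<in> {x. plamenevskaya_type H x}"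
      using alternating_plamenevskaya_type[OF H, of \<rho> "\<lambda>_. False"]
      by (simp add: scale[of _ _ False] transverse_invariant_def)
  next
    fix x assume "x \<in> {x. plamenevskaya_type H x}"
    then have x: "plamenevskaya_type H x" by simp
    obtain \<rho> \<epsilon> where \<rho>: "transverse_invariant \<rho>" "\<forall>B. \<rho> B \<noteq> 0"
      and xeq: "x = (\<lambda>B. strand_state (closure_diagram B) (alternating (\<rho> B) (\<epsilon> B)))"
      by (rule plamenevskaya_type_coefficients[OF x H])
    have "x = (\<lambda>B. scale (\<rho> B) (beta B))"
    proof
      show "x B = scale (\<rho> B) (beta B)" for B unfolding xeq by (rule scale[symmetric])
    qed
    with \<rho> show "\<exists>\<rho>\<in>{\<rho>. transverse_invariant \<rho> \<and> (\<forall>B. \<rho> B \<noteq> 0)}. x = (\<lambda>B. scale (\<rho> B) (beta B))"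
      by blast
  qed
qed

lemma bij_betw_signed_coefficients:
  assumes H: "homotopy_choice H" and ne: "x1 \<noteq> x2"
  shows "bij_betw (\<lambda>(\<rho>, \<epsilon>) B. scale (\<rho> B) (if \<epsilon> B then beta_bar B else beta B))
    ({\<rho>. transverse_invariant \<rho> \<and> (\<forall>B. \<rho> B \<noteq> 0)} \<times> {\<epsilon>. transverse_invariant \<epsilon>})
    {x. plamenevskaya_type H x}"
  unfolding scale_beta
proof (rule bij_betwI')
  let ?F = "\<lambda>(\<rho>, \<epsilon>) B. strand_state (closure_diagram B) (alternating (\<rho> B) (\<epsilon> B))"
  let ?S = "{\<rho> :: braid \<Rightarrow> 'r. transverse_invariant \<rho> \<and> (\<forall>B. \<rho> B \<noteq> 0)} \<times>
    {\<epsilon> :: braid \<Rightarrow> bool. transverse_invariant \<epsilon>}"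
  fix u assume u: "u \<in> ?S"
  obtain \<rho> \<epsilon> where u': "u = (\<rho>, \<epsilon>)" by (cases u)
  then have inv: "transverse_invariant \<rho>" "\<forall>B. \<rho> B \<noteq> 0" "transverse_invariant \<epsilon>" using u by auto
  show "?F u \<in> {x. plamenevskaya_type H x}"
    using alternating_plamenevskaya_type[OF H inv] by (simp add: u')
  show "?F u = ?F v \<longleftrightarrow> u = v" if "v \<in> ?S" for v
  proof
    assume eq: "?F u = ?F v"
    obtain \<rho>' \<epsilon>' where v: "v = (\<rho>', \<epsilon>')" by (cases v)
    have "strand_state (closure_diagram B) (alternating (\<rho> B) (\<epsilon> B)) =
        strand_state (closure_diagram B) (alternating (\<rho>' B) (\<epsilon>' B))" for B
      using fun_cong[OF eq, of B] by (simp add: u' v)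
    then have "\<rho> B = \<rho>' B \<and> \<epsilon> B = \<epsilon>' B" for B
      using alternating_eqD inv(2) ne by blast
    then show "u = v" by (simp add: u' v fun_eq_iff)
  qed simp
next
  fix x assume "x \<in> {x. plamenevskaya_type H x}"
  then have x: "plamenevskaya_type H x" by simp
  obtain \<rho> \<epsilon> where "transverse_invariant \<rho>" "\<forall>B. \<rho> B \<noteq> 0" "x1 \<noteq> x2 \<longrightarrow> transverse_invariant \<epsilon>"
    and "x = (\<lambda>B. strand_state (closure_diagram B) (alternating (\<rho> B) (\<epsilon> B)))"
    by (rule plamenevskaya_type_coefficients[OF x H])
  with ne show "\<exists>u\<in>{\<rho>. transverse_invariant \<rho> \<and> (\<forall>B. \<rho> B \<noteq> 0)} \<times> {\<epsilon>. transverse_invariant \<epsilon>}.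
      x = (\<lambda>(\<rho>, \<epsilon>) B. strand_state (closure_diagram B) (alternating (\<rho> B) (\<epsilon> B))) u"
    by (intro bexI[of _ "(\<rho>, \<epsilon>)"]) auto
qed

lemma plamenevskaya_types_eqpoll_invariants:
  assumes H: "homotopy_choice H" and "\<not> (card (UNIV :: 'r set) = 2 \<and> x1 = x2)"
  shows "{x. plamenevskaya_type H x} \<approx> {\<rho> :: braid \<Rightarrow> 'r. transverse_invariant \<rho>}"
proof -
  show ?thesis
  proof (cases "x1 = x2")
    case True
    then have "invariants_into (UNIV - {0 :: 'r}) \<approx> {x. plamenevskaya_type H x}"
      using bij_betw_coefficients[OF H True] unfolding nonvanishing_invariants eqpoll_def by blast
    moreover have "invariants_into (UNIV - {0 :: 'r}) \<approx> invariants_into (UNIV :: 'r set)"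
      using assms(2) True by (intro nonvanishing_invariants_eqpoll) simp
    ultimately show ?thesis
      unfolding invariants_into_UNIV by (meson eqpoll_sym eqpoll_trans)
  next
    case False
    then have "invariants_into (UNIV - {0 :: 'r}) \<times> invariants_into (UNIV :: bool set) \<approx>
        {x. plamenevskaya_type H x}"
      using bij_betw_signed_coefficients[OF H False] unfolding nonvanishing_invariants invariants_into_UNIV eqpoll_def by blast
    then show ?thesis
      unfolding invariants_into_UNIV using signed_nonvanishing_invariants_eqpoll[where 'r = 'r] eqpoll_sym eqpoll_trans by blast
  qed
qed

end

theorem theorem1p4:
  fixes p q :: "'f::field poly poly"
    and x1 x2 :: "'r::idom"
    and H :: "diagram \<Rightarrow> nat \<Rightarrow> 'r chain \<Rightarrow> 'r chain"
  assumes "primeideal (Idl\<^bsub>ring_of_type_algebra\<^esub> {p, q}) ring_of_type_algebra"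
    and "(ring_of_type_algebra Quot (Idl\<^bsub>ring_of_type_algebra\<^esub> {p, q})) \<simeq>
           (ring_of_type_algebra :: 'r ring)"
    and "factorial_domain (ring_of_type_algebra :: 'r ring)"
    and "frobenius_algebra.homotopy_choice x1 x2 H"
  shows
    "(\<forall>x. frobenius_algebra.plamenevskaya_type x1 x2 H x \<longrightarrow>
        (\<forall>B. \<exists>r. x B = scale r (frobenius_algebra.beta x1 x2 B) \<or>
                 x B = scale r (frobenius_algebra.beta_bar x1 x2 B))) \<and>
     (x1 = x2 \<longrightarrow>
        bij_betw (\<lambda>\<rho> B. scale (\<rho> B) (frobenius_algebra.beta x1 x2 B))
          {\<rho>. transverse_invariant \<rho> \<and> (\<forall>B. \<rho> B \<noteq> 0)}
          {x. frobenius_algebra.plamenevskaya_type x1 x2 H x}) \<and>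
     (x1 \<noteq> x2 \<longrightarrow>
        bij_betw (\<lambda>(\<rho>, \<epsilon>) B. scale (\<rho> B) (if \<epsilon> B then frobenius_algebra.beta_bar x1 x2 B
                                              else frobenius_algebra.beta x1 x2 B))
          ({\<rho>. transverse_invariant \<rho> \<and> (\<forall>B. \<rho> B \<noteq> 0)} \<times>
           {\<epsilon> :: braid \<Rightarrow> bool. transverse_invariant \<epsilon>})
          {x. frobenius_algebra.plamenevskaya_type x1 x2 H x}) \<and>
     (\<not> (card (UNIV :: 'r set) = 2 \<and> x1 = x2) \<longrightarrow>
        (\<exists>F. bij_betw F {x. frobenius_algebra.plamenevskaya_type x1 x2 H x}
          {\<rho> :: braid \<Rightarrow> 'r. transverse_invariant \<rho>}))"
proof -
  interpret frobenius_algebra x1 x2 .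
  have form: "\<exists>r. x B = scale r (beta B) \<or> x B = scale r (beta_bar B)" if x: "plamenevskaya_type H x" for x B
  proof -
    obtain r e where "x B = strand_state (closure_diagram B) (alternating r e)"
      using plamenevskaya_type_alternating[OF x assms(4)] by blast
    then have "x B = scale r (if e then beta_bar B else beta B)" by (simp only: scale_beta)
    then show ?thesis by (auto split: if_splits)
  qed
  show ?thesis
    using form
    by (intro conjI impI allI bij_betw_coefficients[OF assms(4)] bij_betw_signed_coefficients[OF assms(4)]
        plamenevskaya_types_eqpoll_invariants[OF assms(4), unfolded eqpoll_def])
qed

end
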